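(* Let $(M,\varphi)$ be a $7$-manifold with coclosed $G_2$-structure. Then, with respect to the standard Lie bracket $[\cdot,\cdot]$ of vector fields, $\mathcal{X}_{coRoc}(M)$ and $\mathcal{X}_{coG_2}(M)$ are Lie subalgebras of $\mathcal{X}(M)$, and there are inclusions of Lie algebras $$(\mathcal{X}_{coRoc}(M),[\cdot,\cdot])\subseteq(\mathcal{X}_{coG_2}(M),[\cdot,\cdot])\subseteq(\mathcal{X}(M),[\cdot,\cdot]).$$
   Context: On $\mathbb{R}^7$ let $\varphi_0=dx^{123}+dx^{145}+dx^{167}+dx^{246}-dx^{257}-dx^{347}-dx^{356}$, where $dx^{ijk}=dx^i\wedge dx^j\wedge dx^k$. A $G_2$-structure on a smooth $7$-manifold $M$ is a smooth $3$-form $\varphi$ such that for each $p\in M$ there is a linear isomorphism $T_pM\cong\mathbb{R}^7$ carrying $\varphi_p$ to $\varphi_0$. It determines a Riemannian metric $\langle\cdot,\cdot\rangle_\varphi$ and an orientation by $(X\lrcorner\varphi)\wedge(Y\lrcorner\varphi)\wedge\varphi=6\langle X,Y\rangle_\varphi\, d\mathrm{vol}_\varphi$; $\star$ is the associated Hodge star. The structure is coclosed if $d^*\varphi=0$, equivalently $d(\star\varphi)=0$. $\mathcal{X}(M)$ is the space of smooth vector fields and $\Omega^3_7(M)=\{X\lrcorner\star\varphi: X\in\mathcal{X}(M)\}$, where $X\lrcorner\omega=\omega(X,\cdot,\dots)$. The map $X\mapsto X\lrcorner\star\varphi$ is injective. Let $(M,\varphi)$ have a coclosed $G_2$-structure.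 A coRochesterian $2$-form is a $2$-form $\sigma$ with $d\sigma\in\Omega^3_7(M)$; its coRochesterian vector field is the unique vector field $X_\sigma$ with $X_\sigma\lrcorner\star\varphi=d\sigma$. $\mathcal{X}_{coRoc}(M)$ is the set of all such vector fields $X_\sigma$. A co$G_2$-vector field is a vector field $X$ with $\mathcal{L}_X(\star\varphi)=0$; the set of these is $\mathcal{X}_{coG_2}(M)$. *)

theory Defs
  imports
    "HOL-Analysis.Analysis"
    "HOL-Combinatorics.Permutations"
    "HOL-Library.Function_Algebras"
begin

section \<open>Pointwise vector space structure on functions\<close>

instantiation "fun" :: (type, real_vector) real_vector
begin

definition scaleR_fun_def: "r *\<^sub>R f = (\<lambda>x. r *\<^sub>R f x)"

instance
  by standard (simp_all add: scaleR_fun_def plus_fun_def fun_eq_iff algebra_simps)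

end


section \<open>Lie algebras\<close>

definition lie_algebra :: "'v::real_vector set \<Rightarrow> ('v \<Rightarrow> 'v \<Rightarrow> 'v) \<Rightarrow> bool" where
  "lie_algebra L br \<longleftrightarrow>
     subspace L \<and>
     (\<forall>x\<in>L. \<forall>y\<in>L. br x y \<in> L) \<and>
     (\<forall>x\<in>L. \<forall>y\<in>L. \<forall>z\<in>L. \<forall>a b.
        br (a *\<^sub>R x + b *\<^sub>R y) z = a *\<^sub>R br x z + b *\<^sub>R br y z \<and>
        br z (a *\<^sub>R x + b *\<^sub>R y) = a *\<^sub>R br z x + b *\<^sub>R br z y) \<and>
     (\<forall>x\<in>L. br x x = 0) \<and>
     (\<forall>x\<in>L. \<forall>y\<in>L. \<forall>z\<in>L. br x (br y z) + br y (br z x) + br z (br x y) = 0)"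

definition lie_subalgebra :: "'v::real_vector set \<Rightarrow> 'v set \<Rightarrow> ('v \<Rightarrow> 'v \<Rightarrow> 'v) \<Rightarrow> bool" where
  "lie_subalgebra K L br \<longleftrightarrow>
     lie_algebra L br \<and> K \<subseteq> L \<and> subspace K \<and> (\<forall>x\<in>K. \<forall>y\<in>K. br x y \<in> K)"


section \<open>Alternating forms on a subspace of a real vector space\<close>

text \<open>A form of degree \<open>k\<close> on \<open>V\<close> is a function on lists of vectors; only its values on lists of
  length \<open>k\<close> with entries in \<open>V\<close> are meaningful.\<close>

definition vec_lists :: "'v set \<Rightarrow> nat \<Rightarrow> 'v list set" where
  "vec_lists V k = {vs. set vs \<subseteq> V \<and> length vs = k}"

definition alternating_form :: "'v::real_vector set \<Rightarrow> nat \<Rightarrow> ('v list \<Rightarrow> real) \<Rightarrow> bool" where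
  "alternating_form V k \<alpha> \<longleftrightarrow>
     (\<forall>vs\<in>vec_lists V k. \<forall>i<k. \<forall>x\<in>V. \<forall>y\<in>V. \<forall>a b.
        \<alpha> (vs[i := a *\<^sub>R x + b *\<^sub>R y]) = a * \<alpha> (vs[i := x]) + b * \<alpha> (vs[i := y])) \<and>
     (\<forall>vs\<in>vec_lists V k. \<forall>i<k. \<forall>j<k. i \<noteq> j \<and> vs ! i = vs ! j \<longrightarrow> \<alpha> vs = 0)"

definition interior :: "'v \<Rightarrow> ('v list \<Rightarrow> real) \<Rightarrow> 'v list \<Rightarrow> real" where
  "interior v \<alpha> = (\<lambda>vs. \<alpha> (v # vs))"

text \<open>Normalised so that the wedge product of \<open>k\<close> covectors is the determinant of their values.\<close>

definition wedge ::
    "nat \<Rightarrow> nat \<Rightarrow> ('v list \<Rightarrow> real) \<Rightarrow> ('v list \<Rightarrow> real) \<Rightarrow> 'v list \<Rightarrow> real" where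
  "wedge k l \<alpha> \<beta> vs =
     (\<Sum>\<pi> | \<pi> permutes {..<k+l}. of_int (sign \<pi>)
        * \<alpha> (map (\<lambda>i. vs ! \<pi> i) [0..<k]) * \<beta> (map (\<lambda>i. vs ! \<pi> i) [k..<k+l]))
     / (fact k * fact l)"

definition inner_product_on :: "'v::real_vector set \<Rightarrow> ('v \<Rightarrow> 'v \<Rightarrow> real) \<Rightarrow> bool" where
  "inner_product_on V g \<longleftrightarrow>
     (\<forall>x\<in>V. \<forall>y\<in>V. g x y = g y x) \<and>
     (\<forall>x\<in>V. \<forall>y\<in>V. \<forall>z\<in>V. \<forall>a b. g (a *\<^sub>R x + b *\<^sub>R y) z = a * g x z + b * g y z) \<and>
     (\<forall>x\<in>V. x \<noteq> 0 \<longrightarrow> g x x > 0)"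

definition orthonormal_basis ::
    "'v::real_vector set \<Rightarrow> ('v \<Rightarrow> 'v \<Rightarrow> real) \<Rightarrow> 'v list \<Rightarrow> bool" where
  "orthonormal_basis V g es \<longleftrightarrow>
     set es \<subseteq> V \<and> V \<subseteq> span (set es) \<and>
     (\<forall>i<length es. \<forall>j<length es. g (es ! i) (es ! j) = (if i = j then 1 else 0))"

text \<open>A volume form fixes the orientation: an orthonormal basis is positive iff \<open>\<mu>\<close> is 1 on it.\<close>

definition volume_form ::
    "'v::real_vector set \<Rightarrow> nat \<Rightarrow> ('v \<Rightarrow> 'v \<Rightarrow> real) \<Rightarrow> ('v list \<Rightarrow> real) \<Rightarrow> bool" where
  "volume_form V n g \<mu> \<longleftrightarrow>
     alternating_form V n \<mu> \<and> (\<forall>es. orthonormal_basis V g es \<longrightarrow> \<bar>\<mu> es\<bar> = 1)"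

text \<open>The inner product of \<open>k\<close>-forms for which the \<open>e\<^sup>I\<close> with \<open>I\<close> increasing are orthonormal.\<close>

definition form_inner ::
    "'v::real_vector set \<Rightarrow> ('v \<Rightarrow> 'v \<Rightarrow> real) \<Rightarrow> nat \<Rightarrow>
     ('v list \<Rightarrow> real) \<Rightarrow> ('v list \<Rightarrow> real) \<Rightarrow> real" where
  "form_inner V g k \<alpha> \<beta> =
     (let es = (SOME es. orthonormal_basis V g es)
      in \<Sum>I | I \<subseteq> {..<length es} \<and> card I = k. \<alpha> (nths es I) * \<beta> (nths es I))"

text \<open>Characterised by \<open>\<alpha> \<and> \<star>\<omega> = \<langle>\<alpha>, \<omega>\<rangle> \<mu>\<close>, which determines \<open>\<star>\<omega>\<close> on all lists in
  \<open>vec_lists V (n - k)\<close>.\<close>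

definition hodge_star ::
    "'v::real_vector set \<Rightarrow> nat \<Rightarrow> ('v \<Rightarrow> 'v \<Rightarrow> real) \<Rightarrow> ('v list \<Rightarrow> real) \<Rightarrow> nat \<Rightarrow>
     ('v list \<Rightarrow> real) \<Rightarrow> 'v list \<Rightarrow> real" where
  "hodge_star V n g \<mu> k \<omega> =
     (SOME \<psi>. alternating_form V (n - k) \<psi> \<and>
        (\<forall>\<alpha>. alternating_form V k \<alpha> \<longrightarrow>
          (\<forall>vs\<in>vec_lists V n. wedge k (n - k) \<alpha> \<psi> vs = form_inner V g k \<alpha> \<omega> * \<mu> vs)))"


section \<open>Smooth manifolds\<close>

text \<open>Used for open \<open>S\<close> in a finite-dimensional space.\<close>

primrec Ck_on ::
    "nat \<Rightarrow> 'a::real_normed_vector set \<Rightarrow> ('a \<Rightarrow> 'b::real_normed_vector) \<Rightarrow> bool" where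
  "Ck_on 0 S f \<longleftrightarrow> continuous_on S f"
| "Ck_on (Suc n) S f \<longleftrightarrow>
     (\<forall>x\<in>S. f differentiable (at x)) \<and>
     (\<forall>v. Ck_on n S (\<lambda>x. frechet_derivative f (at x) v))"

definition smooth_on ::
    "'a::real_normed_vector set \<Rightarrow> ('a \<Rightarrow> 'b::real_normed_vector) \<Rightarrow> bool" where
  "smooth_on S f \<longleftrightarrow> (\<forall>n. Ck_on n S f)"

type_synonym ('a, 'n) atlas = "('a set \<times> ('a \<Rightarrow> real ^ 'n)) set"

text \<open>The underlying space of the manifold is the whole type \<open>'a\<close>; being Hausdorff and second
  countable are the type class constraints.\<close>

definition smooth_manifold ::
    "('a::{t2_space, second_countable_topology}, 'n::finite) atlas \<Rightarrow> bool" where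
  "smooth_manifold A \<longleftrightarrow>
     (\<Union>(U, h)\<in>A. U) = UNIV \<and>
     (\<forall>(U, h)\<in>A. open U \<and> open (h ` U) \<and> homeomorphism U (h ` U) h (inv_into U h)) \<and>
     (\<forall>(U, h)\<in>A. \<forall>(V, k)\<in>A. smooth_on (h ` (U \<inter> V)) (k \<circ> inv_into U h))"

definition smooth_functions :: "('a, 'n::finite) atlas \<Rightarrow> ('a \<Rightarrow> real) set" where
  "smooth_functions A = {f. \<forall>(U, h)\<in>A. smooth_on (h ` U) (f \<circ> inv_into U h)}"

type_synonym 'a tvec = "('a \<Rightarrow> real) \<Rightarrow> real"

text \<open>Tangent vectors at \<open>p\<close> are the derivations at \<open>p\<close> of the algebra of smooth functions,
  extended by 0 to all functions so that each derivation is represented exactly once.\<close>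

definition tangent_space :: "('a, 'n::finite) atlas \<Rightarrow> 'a \<Rightarrow> 'a tvec set" where
  "tangent_space A p =
     {v. (\<forall>f\<in>smooth_functions A. \<forall>g\<in>smooth_functions A. \<forall>a b.
            v (\<lambda>x. a * f x + b * g x) = a * v f + b * v g) \<and>
         (\<forall>f\<in>smooth_functions A. \<forall>g\<in>smooth_functions A.
            v (\<lambda>x. f x * g x) = f p * v g + g p * v f) \<and>
         (\<forall>f. f \<notin> smooth_functions A \<longrightarrow> v f = 0)}"

type_synonym 'a vfield = "'a \<Rightarrow> 'a tvec"

definition vector_fields :: "('a, 'n::finite) atlas \<Rightarrow> 'a vfield set" where
  "vector_fields A =
     {X. (\<forall>p. X p \<in> tangent_space A p) \<and>
         (\<forall>f\<in>smooth_functions A. (\<lambda>p. X p f) \<in> smooth_functions A)}"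

definition lie_bracket :: "'a vfield \<Rightarrow> 'a vfield \<Rightarrow> 'a vfield" where
  "lie_bracket X Y = (\<lambda>p f. X p (\<lambda>q. Y q f) - Y p (\<lambda>q. X q f))"


section \<open>Differential forms\<close>

type_synonym 'a dform = "'a \<Rightarrow> 'a tvec list \<Rightarrow> real"

definition eval_form :: "'a dform \<Rightarrow> 'a vfield list \<Rightarrow> 'a \<Rightarrow> real" where
  "eval_form \<omega> Ys = (\<lambda>p. \<omega> p (map (\<lambda>Y. Y p) Ys))"

definition diff_form :: "('a, 'n::finite) atlas \<Rightarrow> nat \<Rightarrow> 'a dform \<Rightarrow> bool" where
  "diff_form A k \<omega> \<longleftrightarrow>
     (\<forall>p. alternating_form (tangent_space A p) k (\<omega> p)) \<and>
     (\<forall>Ys\<in>vec_lists (vector_fields A) k. eval_form \<omega> Ys \<in> smooth_functions A)"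

definition interior_field :: "'a vfield \<Rightarrow> 'a dform \<Rightarrow> 'a dform" where
  "interior_field X \<omega> = (\<lambda>p. interior (X p) (\<omega> p))"

text \<open>\<open>has_ext_deriv A k \<omega> \<eta>\<close>: \<open>\<omega>\<close> is a smooth \<open>k\<close>-form, \<open>\<eta>\<close> a smooth \<open>(k + 1)\<close>-form, and
  \<open>d\<omega> = \<eta>\<close>. The exterior derivative is given by the invariant formula, \<open>\<omega>\<close> and \<open>\<eta>\<close> being
  regarded as multilinear maps on vector fields. Note that \<open>nths Ys (-{i})\<close> is \<open>Ys\<close> without its
  \<open>i\<close>-th entry.\<close>

definition ext_deriv :: "nat \<Rightarrow> 'a dform \<Rightarrow> 'a vfield list \<Rightarrow> 'a \<Rightarrow> real" where
  "ext_deriv k \<omega> Ys = (\<lambda>p.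
     (\<Sum>i\<le>k. (-1) ^ i * (Ys ! i) p (eval_form \<omega> (nths Ys (-{i})))) +
     (\<Sum>j\<le>k. \<Sum>i<j. (-1) ^ (i + j)
        * eval_form \<omega> (lie_bracket (Ys ! i) (Ys ! j) # nths Ys (-{i, j})) p))"

definition has_ext_deriv ::
    "('a, 'n::finite) atlas \<Rightarrow> nat \<Rightarrow> 'a dform \<Rightarrow> 'a dform \<Rightarrow> bool" where
  "has_ext_deriv A k \<omega> \<eta> \<longleftrightarrow>
     diff_form A k \<omega> \<and> diff_form A (Suc k) \<eta> \<and>
     (\<forall>Ys\<in>vec_lists (vector_fields A) (Suc k). ext_deriv k \<omega> Ys = eval_form \<eta> Ys)"

text \<open>Likewise \<open>has_lie_deriv A X k \<omega> \<eta>\<close> means that the Lie derivative of \<open>\<omega>\<close> along \<open>X\<close> is \<open>\<eta>\<close>.\<close>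

definition lie_deriv :: "'a vfield \<Rightarrow> 'a dform \<Rightarrow> 'a vfield list \<Rightarrow> 'a \<Rightarrow> real" where
  "lie_deriv X \<omega> Ys = (\<lambda>p. X p (eval_form \<omega> Ys) -
     (\<Sum>i<length Ys. eval_form \<omega> (Ys[i := lie_bracket X (Ys ! i)]) p))"

definition has_lie_deriv ::
    "('a, 'n::finite) atlas \<Rightarrow> 'a vfield \<Rightarrow> nat \<Rightarrow> 'a dform \<Rightarrow> 'a dform \<Rightarrow> bool" where
  "has_lie_deriv A X k \<omega> \<eta> \<longleftrightarrow>
     diff_form A k \<omega> \<and> diff_form A k \<eta> \<and>
     (\<forall>Ys\<in>vec_lists (vector_fields A) k. lie_deriv X \<omega> Ys = eval_form \<eta> Ys)"


section \<open>\<open>G\<^sub>2\<close>-structures\<close>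

definition dx3 :: "7 \<Rightarrow> 7 \<Rightarrow> 7 \<Rightarrow> (real ^ 7) list \<Rightarrow> real" where
  "dx3 i j k =
     (let dx = (\<lambda>m vs. hd vs $ m) in wedge 2 1 (wedge 1 1 (dx i) (dx j)) (dx k))"

definition phi0 :: "(real ^ 7) list \<Rightarrow> real" where
  "phi0 vs = dx3 1 2 3 vs + dx3 1 4 5 vs + dx3 1 6 7 vs + dx3 2 4 6 vs
     - dx3 2 5 7 vs - dx3 3 4 7 vs - dx3 3 5 6 vs"

definition g2_structure :: "('a, 7) atlas \<Rightarrow> 'a dform \<Rightarrow> bool" where
  "g2_structure A \<phi> \<longleftrightarrow>
     diff_form A 3 \<phi> \<and>
     (\<forall>p. \<exists>u :: real ^ 7 \<Rightarrow> 'a tvec.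
        linear u \<and> bij_betw u UNIV (tangent_space A p) \<and>
        (\<forall>x y z. \<phi> p [u x, u y, u z] = phi0 [x, y, z]))"

text \<open>For a form \<open>\<phi>\<close> on \<open>V\<close> equivalent to \<open>phi0\<close>, the following relation determines both \<open>g\<close> on \<open>V\<close>
  and \<open>\<mu>\<close> on \<open>vec_lists V 7\<close>. (Outside \<open>V\<close> their values are arbitrary, hence \<open>SOME\<close> below.)\<close>

definition g2_metric_volume ::
    "'v::real_vector set \<Rightarrow> ('v list \<Rightarrow> real) \<Rightarrow> ('v \<Rightarrow> 'v \<Rightarrow> real) \<Rightarrow> ('v list \<Rightarrow> real) \<Rightarrow> bool" where
  "g2_metric_volume V \<phi> g \<mu> \<longleftrightarrow>
     inner_product_on V g \<and> volume_form V 7 g \<mu> \<and>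
     (\<forall>x\<in>V. \<forall>y\<in>V. \<forall>vs\<in>vec_lists V 7.
        wedge 4 3 (wedge 2 2 (interior x \<phi>) (interior y \<phi>)) \<phi> vs = 6 * g x y * \<mu> vs)"

definition g2_star :: "('a, 7) atlas \<Rightarrow> 'a dform \<Rightarrow> 'a dform" where
  "g2_star A \<phi> = (\<lambda>p.
     let (g, \<mu>) = (SOME (g, \<mu>). g2_metric_volume (tangent_space A p) (\<phi> p) g \<mu>)
     in hodge_star (tangent_space A p) 7 g \<mu> 3 (\<phi> p))"

definition coclosed :: "('a, 7) atlas \<Rightarrow> 'a dform \<Rightarrow> bool" where
  "coclosed A \<phi> \<longleftrightarrow> has_ext_deriv A 4 (g2_star A \<phi>) (\<lambda>p vs. 0)"


section \<open>CoRochesterian and co\<open>G\<^sub>2\<close> vector fields\<close>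

definition Omega37 :: "('a, 7) atlas \<Rightarrow> 'a dform \<Rightarrow> 'a dform set" where
  "Omega37 A \<phi> = {interior_field X (g2_star A \<phi>) | X. X \<in> vector_fields A}"

definition coRochesterian_form :: "('a, 7) atlas \<Rightarrow> 'a dform \<Rightarrow> 'a dform \<Rightarrow> bool" where
  "coRochesterian_form A \<phi> \<sigma> \<longleftrightarrow>
     diff_form A 2 \<sigma> \<and> (\<exists>\<eta>\<in>Omega37 A \<phi>. has_ext_deriv A 2 \<sigma> \<eta>)"

definition coRochesterian_fields :: "('a, 7) atlas \<Rightarrow> 'a dform \<Rightarrow> 'a vfield set" where
  "coRochesterian_fields A \<phi> =
     {X \<in> vector_fields A. \<exists>\<sigma>. coRochesterian_form A \<phi> \<sigma> \<and>
        has_ext_deriv A 2 \<sigma> (interior_field X (g2_star A \<phi>))}"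

definition coG2_fields :: "('a, 7) atlas \<Rightarrow> 'a dform \<Rightarrow> 'a vfield set" where
  "coG2_fields A \<phi> =
     {X \<in> vector_fields A. has_lie_deriv A X 4 (g2_star A \<phi>) (\<lambda>p vs. 0)}"

end

theory Submission
  imports Defs
begin

text \<open>Only \<open>d(\<star>\<phi>) = 0\<close> matters, and only on vector fields: there the invariant formulas make
  forms into cochains of the Lie algebra of vector fields with values in the smooth functions, for
  which Cartan's formula \<open>L\<^sub>X = d \<iota>\<^sub>X + \<iota>\<^sub>X d\<close>, \<open>[L\<^sub>X, L\<^sub>Y] = L\<^bsub>[X,Y]\<^esub>\<close>, \<open>[L\<^sub>X, d] = 0\<close> and \<open>d d = 0\<close> are
  purely algebraic. For a closed form \<open>\<psi>\<close>, \<open>\<iota>\<^sub>X \<psi> = d \<sigma>\<close> gives \<open>L\<^sub>X \<psi> = d d \<sigma> = 0\<close>; and if also \<open>\<iota>\<^sub>Y \<psi>\<close>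
  is exact, then \<open>\<iota>\<^bsub>[X,Y]\<^esub> \<psi> = L\<^sub>X \<iota>\<^sub>Y \<psi> = d \<iota>\<^sub>X \<iota>\<^sub>Y \<psi>\<close>.\<close>

section \<open>Cochains of a Lie algebra with values in a module\<close>

text \<open>The interior product of cochains. It fills the first slot, so that it matches recursion
  on argument lists.\<close>

abbreviation (input) contract :: "'v \<Rightarrow> ('v list \<Rightarrow> 'm) \<Rightarrow> 'v list \<Rightarrow> 'm" where
  "contract x c \<equiv> (\<lambda>vs. c (x # vs))"

section \<open>Argument lists and the deletion of one or two entries\<close>

lemma vec_lists_0: "vec_lists L 0 = {[]}"
  by (auto simp: vec_lists_def)

lemma Cons_in_vec_lists: "x # vs \<in> vec_lists L (Suc k) \<longleftrightarrow> x \<in> L \<and> vs \<in> vec_lists L k"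
  by (auto simp: vec_lists_def)

lemma vec_lists_SucE:
  assumes "vs \<in> vec_lists L (Suc k)"
  obtains x ws where "vs = x # ws" "x \<in> L" "ws \<in> vec_lists L k"
  using assms by (cases vs) (auto simp: vec_lists_def)

lemma length_vec_lists: "vs \<in> vec_lists L k \<Longrightarrow> length vs = k"
  by (auto simp: vec_lists_def)

lemma nth_vec_lists: "vs \<in> vec_lists L k \<Longrightarrow> i < k \<Longrightarrow> vs ! i \<in> L"
  by (auto simp: vec_lists_def)

lemma list_update_vec_lists: "vs \<in> vec_lists L k \<Longrightarrow> x \<in> L \<Longrightarrow> vs[i := x] \<in> vec_lists L k"
  by (auto simp: vec_lists_def dest!: set_update_subset_insert[THEN subsetD])

lemma nths_Cons_minus_0: "nths (x # vs) (- {0}) = vs"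
  by (simp add: nths_Cons nths_all)

lemma nths_Cons_minus_Suc: "nths (x # vs) (- {Suc i}) = x # nths vs (- {i})"
proof -
  have "{j. Suc j \<in> - {Suc i}} = - {i}" by auto
  then show ?thesis by (simp add: nths_Cons)
qed

lemma nths_Cons_minus_0_Suc: "nths (x # vs) (- {0, Suc j}) = nths vs (- {j})"
proof -
  have "{l. Suc l \<in> - {0, Suc j}} = - {j}" by auto
  then show ?thesis by (simp add: nths_Cons)
qed

lemma nths_Cons_minus_Suc_Suc:
  "nths (x # vs) (- {Suc i, Suc j}) = x # nths vs (- {i, j})"
proof -
  have "{l. Suc l \<in> - {Suc i, Suc j}} = - {i, j}" by auto
  then show ?thesis by (simp add: nths_Cons)
qed

text \<open>These cases separate the terms of the invariant formula in which the first argument is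
  deleted from those that keep it; Cartan's formula rests on this split.\<close>

lemmas nths_Cons_minus =
  nths_Cons_minus_0 nths_Cons_minus_Suc nths_Cons_minus_0_Suc nths_Cons_minus_Suc_Suc

lemma nths_minus_one_vec_lists:
  "vs \<in> vec_lists L (Suc k) \<Longrightarrow> i \<le> k \<Longrightarrow> nths vs (- {i}) \<in> vec_lists L k"
proof (induction k arbitrary: vs i)
  case 0
  then show ?case
    by (auto elim!: vec_lists_SucE simp: vec_lists_0 nths_Cons_minus)
next
  case (Suc k)
  then show ?case
    by (cases i; auto elim!: vec_lists_SucE[of _ _ "Suc k"] simp: nths_Cons_minus Cons_in_vec_lists)
qed

lemma nths_minus_two_vec_lists:
  "vs \<in> vec_lists L (Suc (Suc k)) \<Longrightarrow> i < j \<Longrightarrow> j \<le> Suc k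
    \<Longrightarrow> nths vs (- {i, j}) \<in> vec_lists L k"
proof (induction k arbitrary: vs i j)
  case 0
  then have "i = 0" "j = Suc 0" by auto
  with 0 show ?case
    by (auto elim!: vec_lists_SucE simp: vec_lists_0 nths_Cons_minus)
next
  case (Suc k)
  from Suc.prems(1) obtain x ws where vs: "vs = x # ws" "x \<in> L" "ws \<in> vec_lists L (Suc (Suc k))"
    by (rule vec_lists_SucE)
  obtain j' where j: "j = Suc j'" using Suc.prems(2) by (cases j) auto
  show ?case
  proof (cases i)
    case 0
    with vs j Suc.prems show ?thesis by (simp add: nths_Cons_minus nths_minus_one_vec_lists)
  next
    case (Suc i')
    with vs j Suc.prems Suc.IH[of ws i' j'] show ?thesis
      by (simp add: nths_Cons_minus Cons_in_vec_lists)
  qed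
qed

text \<open>A representation of the Lie algebra \<open>L\<close> on \<open>M\<close>; the cochains
  below form its Chevalley-Eilenberg complex. The intended instance is vector fields acting on
  smooth functions, both proper subsets of their types, hence the carrier sets.\<close>

locale lie_module =
  fixes L :: "'v::real_vector set" and br :: "'v \<Rightarrow> 'v \<Rightarrow> 'v"
    and M :: "'m::real_vector set" and act :: "'v \<Rightarrow> 'm \<Rightarrow> 'm"
  assumes lie_algebra: "lie_algebra L br"
    and subspace_module: "subspace M"
    and act_closed: "x \<in> L \<Longrightarrow> f \<in> M \<Longrightarrow> act x f \<in> M"
    and act_linear: "x \<in> L \<Longrightarrow> f \<in> M \<Longrightarrow> g \<in> M \<Longrightarrow>
      act x (a *\<^sub>R f + b *\<^sub>R g) = a *\<^sub>R act x f + b *\<^sub>R act x g"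
    and act_br: "x \<in> L \<Longrightarrow> y \<in> L \<Longrightarrow> f \<in> M \<Longrightarrow>
      act (br x y) f = act x (act y f) - act y (act x f)"
    and act_linear_left: "x \<in> L \<Longrightarrow> y \<in> L \<Longrightarrow> f \<in> M \<Longrightarrow>
      act (a *\<^sub>R x + b *\<^sub>R y) f = a *\<^sub>R act x f + b *\<^sub>R act y f"
begin

section \<open>Identities in the Lie algebra\<close>

lemma br_closed: "x \<in> L \<Longrightarrow> y \<in> L \<Longrightarrow> br x y \<in> L"
  using lie_algebra by (simp add: lie_algebra_def)

lemma subspace_L: "subspace L"
  using lie_algebra by (simp add: lie_algebra_def)

lemma br_linear_right: "x \<in> L \<Longrightarrow> y \<in> L \<Longrightarrow> z \<in> L \<Longrightarrow>
    br z (a *\<^sub>R x + b *\<^sub>R y) = a *\<^sub>R br z x + b *\<^sub>R br z y"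
  using lie_algebra by (simp add: lie_algebra_def)

lemma br_linear_left: "x \<in> L \<Longrightarrow> y \<in> L \<Longrightarrow> z \<in> L \<Longrightarrow>
    br (a *\<^sub>R x + b *\<^sub>R y) z = a *\<^sub>R br x z + b *\<^sub>R br y z"
  using lie_algebra by (simp add: lie_algebra_def)

lemma br_self: "x \<in> L \<Longrightarrow> br x x = 0"
  using lie_algebra by (simp add: lie_algebra_def)

text \<open>Polarisation of \<open>br z z = 0\<close> at \<open>z = x + y\<close>. The coefficients
  \<open>1\<close> in the proof give the sum the shape in which bilinearity is stated.\<close>

lemma br_skew:
  assumes "x \<in> L" "y \<in> L"
  shows "br y x = - br x y"
proof -
  have "x + y \<in> L" using assms subspace_L by (simp add: subspace_add)
  then have "0 = br (1 *\<^sub>R x + 1 *\<^sub>R y) (1 *\<^sub>R x + 1 *\<^sub>R y)" using br_self by simp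
  also have "\<dots> = br x (1 *\<^sub>R x + 1 *\<^sub>R y) + br y (1 *\<^sub>R x + 1 *\<^sub>R y)"
    using assms \<open>x + y \<in> L\<close> br_linear_left[of x y "x + y" 1 1] by simp
  also have "\<dots> = br x y + br y x"
    using assms by (simp only: br_linear_right) (simp add: br_self)
  finally show ?thesis by (simp add: eq_neg_iff_add_eq_0 add.commute)
qed

text \<open>The Jacobi identity as the statement that \<open>br\<close> is a representation of
  \<open>L\<close> on itself, the shape that matches \<open>act_br\<close> and serves
  \<open>lie_act_br\<close>.\<close>

lemma jacobi_derivation:
  assumes "x \<in> L" "y \<in> L" "z \<in> L"
  shows "br (br x y) z = br x (br y z) - br y (br x z)"
proof -
  have "br x (br y z) + br y (br z x) + br z (br x y) = 0"
    using lie_algebra assms by (auto simp: lie_algebra_def)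
  moreover have "br z (br x y) = - br (br x y) z"
    using assms br_skew br_closed by blast
  moreover have "br y (br z x) = - br y (br x z)"
    using assms br_skew[of x z] br_linear_right[of "br x z" "br x z" y "-1" 0] br_closed by simp
  ultimately show ?thesis by (simp add: algebra_simps)
qed

lemma act_zero: "x \<in> L \<Longrightarrow> act x 0 = 0"
  using act_linear[of x 0 0 0 0] subspace_module by (simp add: subspace_0)

text \<open>Alternating multilinear maps \<open>L\<^sup>k \<rightarrow> M\<close>. The recursion on the first argument makes
  induction with Cartan's formula possible.\<close>

primrec cochain :: "nat \<Rightarrow> ('v list \<Rightarrow> 'm) \<Rightarrow> bool" where
  "cochain 0 c \<longleftrightarrow> c [] \<in> M"
| "cochain (Suc k) c \<longleftrightarrow>
     (\<forall>x\<in>L. cochain k (contract x c)) \<and>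
     (\<forall>x\<in>L. \<forall>y\<in>L. \<forall>a b. \<forall>vs\<in>vec_lists L k.
        c ((a *\<^sub>R x + b *\<^sub>R y) # vs) = a *\<^sub>R c (x # vs) + b *\<^sub>R c (y # vs)) \<and>
     (\<forall>x\<in>L. \<forall>vs. x # vs \<in> vec_lists L k \<longrightarrow> c (x # x # vs) = 0)"

text \<open>The formula of \<open>lie_deriv\<close>, with values in the module instead of at a
  point.\<close>

definition lie_act :: "'v \<Rightarrow> ('v list \<Rightarrow> 'm) \<Rightarrow> 'v list \<Rightarrow> 'm" where
  "lie_act x c vs = act x (c vs) - (\<Sum>i<length vs. c (vs[i := br x (vs ! i)]))"

text \<open>The Chevalley-Eilenberg differential, the abstract form of
  \<open>ext_deriv\<close>.\<close>

definition differential :: "nat \<Rightarrow> ('v list \<Rightarrow> 'm) \<Rightarrow> 'v list \<Rightarrow> 'm" where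
  "differential k c vs =
     (\<Sum>i\<le>k. (-1) ^ i *\<^sub>R act (vs ! i) (c (nths vs (-{i})))) +
     (\<Sum>j\<le>k. \<Sum>i<j. (-1) ^ (i + j) *\<^sub>R c (br (vs ! i) (vs ! j) # nths vs (-{i, j})))"

lemma cochain_closed: "cochain k c \<Longrightarrow> vs \<in> vec_lists L k \<Longrightarrow> c vs \<in> M"
proof (induction k arbitrary: c vs)
  case 0
  then show ?case by (simp add: vec_lists_0)
next
  case (Suc k)
  from Suc.prems(2) obtain x ws where "vs = x # ws" "x \<in> L" "ws \<in> vec_lists L k"
    by (rule vec_lists_SucE)
  with Suc.IH[of "contract x c"] Suc.prems(1) show ?case by simp
qed

lemma cochain_contract: "cochain (Suc k) c \<Longrightarrow> x \<in> L \<Longrightarrow> cochain k (contract x c)"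
  by simp

lemma cochain_linear:
  "cochain (Suc k) c \<Longrightarrow> x \<in> L \<Longrightarrow> y \<in> L \<Longrightarrow> vs \<in> vec_lists L k \<Longrightarrow>
    c ((a *\<^sub>R x + b *\<^sub>R y) # vs) = a *\<^sub>R c (x # vs) + b *\<^sub>R c (y # vs)"
  by simp

lemma cochain_diff_arg:
  "cochain (Suc k) c \<Longrightarrow> x \<in> L \<Longrightarrow> y \<in> L \<Longrightarrow> vs \<in> vec_lists L k \<Longrightarrow>
    c ((x - y) # vs) = c (x # vs) - c (y # vs)"
  using cochain_linear[of k c x y vs 1 "-1"] by simp

lemma cochain_comb:
  "cochain k c \<Longrightarrow> cochain k c' \<Longrightarrow> cochain k (\<lambda>vs. a *\<^sub>R c vs + b *\<^sub>R c' vs)"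
proof (induction k arbitrary: c c')
  case 0
  then show ?case using subspace_module by (simp add: subspace_add subspace_scale)
next
  case (Suc k)
  then show ?case by (simp add: algebra_simps)
qed

lemma cochain_diff: "cochain k c \<Longrightarrow> cochain k c' \<Longrightarrow> cochain k (\<lambda>vs. c vs - c' vs)"
  using cochain_comb[of k c c' 1 "-1"] by simp

text \<open>Polarisation again. \<open>cochain\<close> demands alternation only in the first two
  slots, but does so for all contractions too, so this reaches every adjacent pair.\<close>

lemma cochain_swap:
  assumes "cochain (Suc (Suc k)) c" "x \<in> L" "y \<in> L" "vs \<in> vec_lists L k"
  shows "c (x # y # vs) = - c (y # x # vs)"
proof -
  have xy: "x + y \<in> L" using assms subspace_L by (simp add: subspace_add)
  have alt: "c (z # z # vs) = 0" if "z \<in> L" for z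
    using assms that by (simp add: Cons_in_vec_lists)
  have add1: "c ((x + y) # z # vs) = c (x # z # vs) + c (y # z # vs)" if "z \<in> L" for z
    using cochain_linear[OF assms(1-3), of "z # vs" 1 1] that assms by (simp add: Cons_in_vec_lists)
  have add2: "c (z # (x + y) # vs) = c (z # x # vs) + c (z # y # vs)" if "z \<in> L" for z
    using cochain_linear[OF cochain_contract[OF assms(1) that] assms(2-4), of 1 1] by simp
  have "0 = c (x # y # vs) + c (y # x # vs)"
  proof -
    have "0 = c ((x + y) # (x + y) # vs)" using alt[OF xy] by simp
    also have "\<dots> = c (x # x # vs) + c (x # y # vs) + (c (y # x # vs) + c (y # y # vs))"
      by (simp only: add1[OF xy] add2[OF assms(2)] add2[OF assms(3)])
    finally show ?thesis by (simp add: alt assms)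
  qed
  then show ?thesis by (simp add: eq_neg_iff_add_eq_0)
qed

text \<open>Moving \<open>x\<close> from the front to place \<open>i\<close> takes \<open>i\<close>
  adjacent swaps, one per induction step. This links \<open>differential\<close>, where brackets
  stand in front, with \<open>lie_act\<close>, where they stand in place.\<close>

lemma cochain_move_head:
  assumes "cochain k c" "vs \<in> vec_lists L k" "x \<in> L" "i < k"
  shows "c (x # nths vs (- {i})) = (-1) ^ i *\<^sub>R c (vs[i := x])"
  using assms
proof (induction i arbitrary: k c vs)
  case 0
  then obtain k' where k: "k = Suc k'" by (cases k) auto
  with 0 obtain z ws where "vs = z # ws" by (auto elim: vec_lists_SucE)
  then show ?case by (simp add: nths_Cons_minus)
next
  case (Suc i)
  then obtain k' where k: "k = Suc (Suc k')" by (cases k; cases "k - 1") auto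
  with Suc.prems obtain z ws where vs: "vs = z # ws" "z \<in> L" "ws \<in> vec_lists L (Suc k')"
    by (auto elim: vec_lists_SucE)
  have "c (x # z # nths ws (- {i})) = - contract z c (x # nths ws (- {i}))"
    using Suc.prems k vs nths_minus_one_vec_lists[of ws L k' i] by (intro cochain_swap) auto
  also have "\<dots> = - ((-1) ^ i *\<^sub>R contract z c (ws[i := x]))"
    using Suc.prems k vs by (subst Suc.IH[of "Suc k'"]) auto
  finally show ?case using vs by (simp add: nths_Cons_minus)
qed

section \<open>The Lie derivative of cochains\<close>

lemma lie_act_Nil [simp]: "lie_act x c [] = act x (c [])"
  by (simp add: lie_act_def)

lemma lie_act_zero: "x \<in> L \<Longrightarrow> lie_act x (\<lambda>_. 0) vs = 0"
  by (simp add: lie_act_def act_zero)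

text \<open>The summand \<open>i = 0\<close> is split off. In operator form this is the commutator
  of L_x with contraction by \<open>y\<close>, which is contraction by \<open>br x y\<close>; the
  inductions on the degree run on it.\<close>

lemma lie_act_Cons: "lie_act x c (y # vs) = lie_act x (contract y c) vs - c (br x y # vs)"
  unfolding lie_act_def by (simp only: length_Cons sum.lessThan_Suc_shift) (simp add: algebra_simps)

text \<open>Identities between cochains hold only on lists over \<open>L\<close>; this allows
  rewriting with them under \<open>lie_act\<close>.\<close>

lemma lie_act_cong:
  assumes "\<And>ws. ws \<in> vec_lists L k \<Longrightarrow> c ws = c' ws" "x \<in> L" "vs \<in> vec_lists L k"
  shows "lie_act x c vs = lie_act x c' vs"
proof -
  have "c (vs[i := br x (vs ! i)]) = c' (vs[i := br x (vs ! i)])" if "i < length vs" for i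
    using that assms(2,3) length_vec_lists[OF assms(3)]
    by (intro assms(1) list_update_vec_lists br_closed nth_vec_lists) auto
  then show ?thesis using assms by (simp add: lie_act_def)
qed

lemma lie_act_comb:
  assumes "cochain k c" "cochain k c'" "x \<in> L" "vs \<in> vec_lists L k"
  shows "lie_act x (\<lambda>vs. a *\<^sub>R c vs + b *\<^sub>R c' vs) vs = a *\<^sub>R lie_act x c vs + b *\<^sub>R lie_act x c' vs"
  using assms
  by (simp add: lie_act_def act_linear cochain_closed sum.distrib scaleR_sum_right algebra_simps)

lemma lie_act_diff:
  assumes "cochain k c" "cochain k c'" "x \<in> L" "vs \<in> vec_lists L k"
  shows "lie_act x (\<lambda>vs. c vs - c' vs) vs = lie_act x c vs - lie_act x c' vs"
  using lie_act_comb[OF assms, of 1 "-1"] by simp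

lemma cochain_lie_act: "cochain k c \<Longrightarrow> x \<in> L \<Longrightarrow> cochain k (lie_act x c)"
proof (induction k arbitrary: c)
  case 0
  then show ?case by (simp add: act_closed)
next
  case (Suc k)
  have "cochain k (contract y (lie_act x c))" if y: "y \<in> L" for y
    unfolding lie_act_Cons
    using Suc y by (intro cochain_diff Suc.IH cochain_contract br_closed)
  moreover have "lie_act x c ((a *\<^sub>R y + b *\<^sub>R z) # vs)
      = a *\<^sub>R lie_act x c (y # vs) + b *\<^sub>R lie_act x c (z # vs)"
    if *: "y \<in> L" "z \<in> L" "vs \<in> vec_lists L k" for y z a b vs
  proof -
    have "lie_act x (contract (a *\<^sub>R y + b *\<^sub>R z) c) vs
        = lie_act x (\<lambda>vs. a *\<^sub>R contract y c vs + b *\<^sub>R contract z c vs) vs"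
      using Suc.prems * by (intro lie_act_cong[of k] cochain_linear)
    also have "\<dots> = a *\<^sub>R lie_act x (contract y c) vs + b *\<^sub>R lie_act x (contract z c) vs"
      using Suc.prems * by (intro lie_act_comb[of k] cochain_contract)
    finally show ?thesis
      unfolding lie_act_Cons using Suc.prems *
      by (simp add: br_linear_right cochain_linear br_closed algebra_simps del: cochain.simps)
  qed
  moreover have "lie_act x c (y # y # vs) = 0" if *: "y # vs \<in> vec_lists L k" for y vs
  proof -
    obtain k' where k: "k = Suc k'" using * by (cases k) (auto simp: vec_lists_def)
    then have y: "y \<in> L" "vs \<in> vec_lists L k'" using * by (auto simp: Cons_in_vec_lists)
    have "lie_act x (contract y (contract y c)) vs = lie_act x (\<lambda>_. 0) vs"
      using Suc.prems y k by (intro lie_act_cong[of k']) (auto simp: Cons_in_vec_lists)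
    also have "\<dots> = 0" using Suc.prems by (simp add: lie_act_zero)
    \<comment> \<open>The remaining terms \<open>c (y # br x y # vs)\<close> and
      \<open>c (br x y # y # vs)\<close> cancel.\<close>
    finally show ?thesis
      using cochain_swap[of k' c y "br x y" vs] Suc.prems y br_closed k
      by (simp add: lie_act_Cons del: cochain.simps)
  qed
  ultimately show ?case by auto
qed

text \<open>Degree 0 is \<open>act_br\<close>. In the induction step the first argument
  \<open>z\<close> is split off; what the induction hypothesis leaves over is the Jacobi identity
  for \<open>x\<close>, \<open>y\<close>, \<open>z\<close>.\<close>

lemma lie_act_br:
  "cochain k c \<Longrightarrow> x \<in> L \<Longrightarrow> y \<in> L \<Longrightarrow> vs \<in> vec_lists L k \<Longrightarrow>
    lie_act (br x y) c vs = lie_act x (lie_act y c) vs - lie_act y (lie_act x c) vs"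
proof (induction k arbitrary: c vs)
  case 0
  then show ?case by (simp add: vec_lists_0 act_br)
next
  case (Suc k)
  note [simp del] = cochain.simps
  from Suc.prems(4) obtain z ws where vs: "vs = z # ws" "z \<in> L" "ws \<in> vec_lists L k"
    by (rule vec_lists_SucE)
  \<comment> \<open>The two middle terms are exchanged by swapping \<open>u\<close> and
    \<open>v\<close>, so they drop out of the commutator.\<close>
  have twice: "lie_act u (lie_act v c) (z # ws) =
      lie_act u (lie_act v (contract z c)) ws - lie_act u (contract (br v z) c) ws
      - lie_act v (contract (br u z) c) ws + c (br v (br u z) # ws)"
    if "u \<in> L" "v \<in> L" for u v
  proof -
    have "lie_act u (contract z (lie_act v c)) ws =
        lie_act u (lie_act v (contract z c)) ws - lie_act u (contract (br v z) c) ws"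
      unfolding lie_act_Cons using Suc.prems vs that
      by (intro lie_act_diff[of k] cochain_lie_act cochain_contract br_closed)
    then show ?thesis by (simp add: lie_act_Cons[of u] lie_act_Cons[of v c "br u z"])
  qed
  have "c (br (br x y) z # ws) = c (br x (br y z) # ws) - c (br y (br x z) # ws)"
    using Suc.prems vs by (simp add: jacobi_derivation cochain_diff_arg[of k] br_closed)
  then show ?case
    using Suc.prems vs Suc.IH[of "contract z c" ws] cochain_contract[of k c z]
    by (simp add: lie_act_Cons[of "br x y"] twice)
qed

section \<open>The differential and Cartan's calculus\<close>

lemma differential_cong:
  assumes "\<And>ws. ws \<in> vec_lists L k \<Longrightarrow> c ws = c' ws" "vs \<in> vec_lists L (Suc k)"
  shows "differential k c vs = differential k c' vs"
proof -
  have 1: "c (nths vs (- {i})) = c' (nths vs (- {i}))" if "i \<le> k" for i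
    using assms that by (simp add: nths_minus_one_vec_lists)
  have 2: "c (br (vs ! i) (vs ! j) # nths vs (- {i, j})) = c' (br (vs ! i) (vs ! j) # nths vs (- {i, j}))"
    if "i < j" "j \<le> k" for i j
  proof (cases k)
    case 0
    with that show ?thesis by simp
  next
    case (Suc k')
    with assms that show ?thesis
      by (intro assms(1)) (auto simp: Cons_in_vec_lists nths_minus_two_vec_lists
          intro!: br_closed nth_vec_lists[of _ _ "Suc k"])
  qed
  show ?thesis unfolding differential_def
    using 1 2 by (intro arg_cong2[where f = "(+)"] sum.cong) auto
qed

lemma differential_zero: "vs \<in> vec_lists L (Suc k) \<Longrightarrow> differential k (\<lambda>_. 0) vs = 0"
  by (auto simp: differential_def act_zero nth_vec_lists intro!: sum.neutral)

lemma differential_comb: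
  assumes "cochain k c" "cochain k c'" "vs \<in> vec_lists L (Suc k)"
  shows "differential k (\<lambda>vs. a *\<^sub>R c vs + b *\<^sub>R c' vs) vs =
    a *\<^sub>R differential k c vs + b *\<^sub>R differential k c' vs"
proof -
  have "(\<Sum>i\<le>k. (-1) ^ i *\<^sub>R act (vs ! i) (a *\<^sub>R c (nths vs (- {i})) + b *\<^sub>R c' (nths vs (- {i})))) =
      (\<Sum>i\<le>k. (-1) ^ i *\<^sub>R (a *\<^sub>R act (vs ! i) (c (nths vs (- {i})))
        + b *\<^sub>R act (vs ! i) (c' (nths vs (- {i})))))"
    using assms
    by (intro sum.cong refl arg_cong[where f = "scaleR _"] act_linear nth_vec_lists[of _ _ "Suc k"]
        cochain_closed[of k] nths_minus_one_vec_lists) auto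
  then show ?thesis
    by (simp add: differential_def sum.distrib scaleR_sum_right algebra_simps)
qed

lemma differential_diff:
  assumes "cochain k c" "cochain k c'" "vs \<in> vec_lists L (Suc k)"
  shows "differential k (\<lambda>vs. c vs - c' vs) vs = differential k c vs - differential k c' vs"
  using differential_comb[OF assms, of 1 "-1"] by simp

lemma differential_0: "differential 0 c [x] = act x (c [])"
  by (simp add: differential_def nths_Cons_minus)

text \<open>The terms on the left are sorted by the role of \<open>x\<close>. Where \<open>x\<close>
  acts or enters a bracket, they add up to \<open>lie_act x c vs\<close>. Where it stays an
  argument, they give minus the differential of the contraction: the sign comes from the index shift
  in the first sum and from one swap in the second.\<close>

theorem cartan_formula:
  assumes "cochain (Suc k) c" "x \<in> L" "vs \<in> vec_lists L (Suc k)"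
  shows "differential (Suc k) c (x # vs) = lie_act x c vs - differential k (contract x c) vs"
proof -
  have head: "c (br x (vs ! j) # nths vs (- {j})) = (-1) ^ j *\<^sub>R c (vs[j := br x (vs ! j)])"
    if "j \<le> k" for j
    using assms that by (intro cochain_move_head[of "Suc k"] br_closed nth_vec_lists[of _ _ "Suc k"]) auto
  have swap: "c (br (vs ! i) (vs ! j) # x # nths vs (- {i, j}))
      = - c (x # br (vs ! i) (vs ! j) # nths vs (- {i, j}))" if "i < j" "j \<le> k" for i j
  proof (cases k)
    case 0
    with that show ?thesis by simp
  next
    case (Suc k')
    with assms that show ?thesis
      by (intro cochain_swap[of k'] br_closed nth_vec_lists[of _ _ "Suc k"] nths_minus_two_vec_lists) auto
  qed
  \<comment> \<open>The pairs \<open>(0, Suc j)\<close> and \<open>(Suc i, Suc j)\<close> are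
    separated: the former change sign, while in the latter both indices shift and the sign
    stays.\<close>
  have "(\<Sum>j\<le>Suc k. \<Sum>i<j. (-1) ^ (i + j) *\<^sub>R
        c (br ((x # vs) ! i) ((x # vs) ! j) # nths (x # vs) (- {i, j})))
      = (\<Sum>j\<le>k. - ((-1) ^ j *\<^sub>R c (br x (vs ! j) # nths vs (- {j})))
         + (\<Sum>i<j. (-1) ^ (i + j) *\<^sub>R c (br (vs ! i) (vs ! j) # x # nths vs (- {i, j}))))"
    by (simp add: sum.atMost_Suc_shift sum.lessThan_Suc_shift nths_Cons_minus del: sum.atMost_Suc sum.lessThan_Suc)
  also have "\<dots> = (\<Sum>j\<le>k. - c (vs[j := br x (vs ! j)])
         + (\<Sum>i<j. - ((-1) ^ (i + j) *\<^sub>R c (x # br (vs ! i) (vs ! j) # nths vs (- {i, j})))))"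
    by (intro sum.cong refl arg_cong2[where f = "(+)"]) (auto simp: head swap simp flip: power_add)
  finally show ?thesis
    using length_vec_lists[OF assms(3)]
    by (simp add: differential_def lie_act_def sum.atMost_Suc_shift nths_Cons_minus sum.distrib
        sum_negf sum_subtractf lessThan_Suc_atMost del: sum.atMost_Suc sum.lessThan_Suc)
qed

text \<open>Transfers the cochain property along Cartan's formula, which holds only on lists over
  \<open>L\<close>.\<close>

lemma cochain_cong:
  "cochain k c \<Longrightarrow> (\<And>vs. vs \<in> vec_lists L k \<Longrightarrow> c vs = c' vs) \<Longrightarrow> cochain k c'"
proof (induction k arbitrary: c c')
  case 0
  then show ?case by (simp add: vec_lists_0)
next
  case (Suc k)
  have eq: "c' (x # vs) = c (x # vs)" if "x \<in> L" "vs \<in> vec_lists L k" for x vs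
    using Suc.prems(2) that by (simp add: Cons_in_vec_lists)
  have "cochain k (contract x c')" if "x \<in> L" for x
    using Suc.IH[of "contract x c" "contract x c'"] Suc.prems(1) that by (simp add: eq)
  moreover have "x # vs \<in> vec_lists L k \<Longrightarrow> x \<in> L" for x vs
    by (auto simp: vec_lists_def)
  ultimately show ?case
    using Suc.prems(1) subspace_L by (auto simp: eq subspace_add subspace_scale)
qed

lemma lie_act_linear_left:
  "cochain k c \<Longrightarrow> x \<in> L \<Longrightarrow> y \<in> L \<Longrightarrow> vs \<in> vec_lists L k \<Longrightarrow>
    lie_act (a *\<^sub>R x + b *\<^sub>R y) c vs = a *\<^sub>R lie_act x c vs + b *\<^sub>R lie_act y c vs"
proof (induction k arbitrary: c vs)
  case 0
  then show ?case by (simp add: vec_lists_0 act_linear_left)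
next
  case (Suc k)
  from Suc.prems(4) obtain z ws where vs: "vs = z # ws" "z \<in> L" "ws \<in> vec_lists L k"
    by (rule vec_lists_SucE)
  then show ?case
    using Suc.prems Suc.IH[of "contract z c" ws] cochain_contract[of k c z]
    by (simp add: lie_act_Cons br_linear_left cochain_linear br_closed algebra_simps del: cochain.simps)
qed

text \<open>By Cartan's formula a contraction of the differential is a Lie derivative minus a
  differential of lower degree, so induction applies.\<close>

lemma cochain_differential: "cochain k c \<Longrightarrow> cochain (Suc k) (differential k c)"
proof (induction k arbitrary: c)
  case 0
  then show ?case
    by (simp add: differential_0 vec_lists_0 act_closed act_linear_left)
next
  case (Suc k)
  note c = Suc.prems
  have con: "cochain (Suc k) (contract x (differential (Suc k) c))" if x: "x \<in> L" for x
    by (rule cochain_cong[of _ "\<lambda>vs. lie_act x c vs - differential k (contract x c) vs"])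
      (use c x in \<open>auto intro!: cochain_diff cochain_lie_act Suc.IH cochain_contract
          simp: cartan_formula simp del: cochain.simps\<close>)
  moreover have "differential (Suc k) c ((a *\<^sub>R x + b *\<^sub>R y) # vs) =
      a *\<^sub>R differential (Suc k) c (x # vs) + b *\<^sub>R differential (Suc k) c (y # vs)"
    if *: "x \<in> L" "y \<in> L" "vs \<in> vec_lists L (Suc k)" for x y a b vs
  proof -
    have xy: "a *\<^sub>R x + b *\<^sub>R y \<in> L"
      using * subspace_L by (simp add: subspace_add subspace_scale)
    have "differential k (contract (a *\<^sub>R x + b *\<^sub>R y) c) vs =
        differential k (\<lambda>vs. a *\<^sub>R contract x c vs + b *\<^sub>R contract y c vs) vs"
      using c * by (intro differential_cong cochain_linear) auto
    also have "\<dots> = a *\<^sub>R differential k (contract x c) vs + b *\<^sub>R differential k (contract y c) vs"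
      using c * by (intro differential_comb cochain_contract)
    finally show ?thesis
      using c * xy by (simp add: cartan_formula lie_act_linear_left[of "Suc k"] algebra_simps
          del: cochain.simps)
  qed
  moreover have "differential (Suc k) c (x # x # vs) = 0" if *: "x # vs \<in> vec_lists L (Suc k)" for x vs
  proof -
    have x: "x \<in> L" "vs \<in> vec_lists L k" using * by (auto simp: Cons_in_vec_lists)
    have "c (br x x # vs) = 0"
      using cochain_linear[OF c x(1) x(1) x(2), of 0 0] x by (simp add: br_self)
    \<comment> \<open>Cartan's formula once more: its last term involves a double contraction with
      \<open>x\<close>, which is zero. Degree 0 is apart, as the formula starts in degree 1.\<close>
    moreover have "differential k (contract x c) (x # vs) = lie_act x (contract x c) vs"
    proof (cases k)
      case 0
      then show ?thesis using x by (simp add: vec_lists_0 differential_0)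
    next
      case (Suc k')
      have "differential k' (contract x (contract x c)) vs = differential k' (\<lambda>_. 0) vs"
        using c x Suc by (intro differential_cong) (auto simp: Cons_in_vec_lists)
      also have "\<dots> = 0" using x Suc by (simp add: differential_zero)
      finally show ?thesis using c x Suc by (simp add: cartan_formula)
    qed
    ultimately show ?thesis using c * x by (simp add: cartan_formula lie_act_Cons del: cochain.simps)
  qed
  ultimately show ?case by (simp only: cochain.simps(2)[of "Suc k"]) blast
qed

text \<open>Contracting \<open>[L\<^sub>x, d] c\<close> with \<open>y\<close> gives \<open>([L\<^sub>x, L\<^sub>y] - L\<^bsub>[x, y]\<^esub>) c\<close> minus
  \<open>[L\<^sub>x, d]\<close> of the contraction of \<open>c\<close> with \<open>y\<close>.\<close>

theorem lie_act_differential: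
  "cochain k c \<Longrightarrow> x \<in> L \<Longrightarrow> vs \<in> vec_lists L (Suc k) \<Longrightarrow>
    lie_act x (differential k c) vs = differential k (lie_act x c) vs"
proof (induction k arbitrary: c vs)
  case 0
  then obtain y where "vs = [y]" "y \<in> L" by (auto elim: vec_lists_SucE simp: vec_lists_0)
  with 0 show ?case by (simp add: lie_act_Cons differential_0 act_br)
next
  case (Suc k)
  note [simp del] = cochain.simps
  note c = Suc.prems(1) and x = Suc.prems(2)
  from Suc.prems(3) obtain y ws where vs: "vs = y # ws" "y \<in> L" "ws \<in> vec_lists L (Suc k)"
    by (rule vec_lists_SucE)
  note cy = cochain_contract[OF c vs(2)]
  have "lie_act x (contract y (differential (Suc k) c)) ws
      = lie_act x (\<lambda>us. lie_act y c us - differential k (contract y c) us) ws"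
    using c x vs by (intro lie_act_cong[of "Suc k"] cartan_formula)
  also have "\<dots> = lie_act x (lie_act y c) ws - lie_act x (differential k (contract y c)) ws"
    using c x vs cy by (intro lie_act_diff[of "Suc k"] cochain_lie_act cochain_differential)
  also have "lie_act x (differential k (contract y c)) ws = differential k (lie_act x (contract y c)) ws"
    using cy x vs by (intro Suc.IH)
  finally have "lie_act x (differential (Suc k) c) (y # ws) =
      lie_act x (lie_act y c) ws - differential k (lie_act x (contract y c)) ws
      - (lie_act (br x y) c ws - differential k (contract (br x y) c) ws)"
    using c x vs by (simp add: lie_act_Cons cartan_formula br_closed)
  also have "lie_act (br x y) c ws = lie_act x (lie_act y c) ws - lie_act y (lie_act x c) ws"
    using c x vs by (intro lie_act_br)
  also have "lie_act x (lie_act y c) ws - differential k (lie_act x (contract y c)) ws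
      - (lie_act x (lie_act y c) ws - lie_act y (lie_act x c) ws - differential k (contract (br x y) c) ws)
      = lie_act y (lie_act x c) ws
        - (differential k (lie_act x (contract y c)) ws - differential k (contract (br x y) c) ws)"
    by simp
  \<comment> \<open>By \<open>lie_act_Cons\<close> the two cochains differ exactly by
    \<open>contract y (lie_act x c)\<close>.\<close>
  also have "differential k (lie_act x (contract y c)) ws - differential k (contract (br x y) c) ws
      = differential k (contract y (lie_act x c)) ws"
    unfolding lie_act_Cons using c cy x vs
    by (intro differential_diff[symmetric] cochain_lie_act cochain_contract br_closed)
  also have "lie_act y (lie_act x c) ws - differential k (contract y (lie_act x c)) ws =
      differential (Suc k) (lie_act x c) (y # ws)"
    using c x vs by (intro cartan_formula[symmetric] cochain_lie_act)
  finally show ?case using vs by simp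
qed

text \<open>Contracting \<open>d d c\<close> with \<open>x\<close> and applying Cartan's formula
  twice gives L_x d c - d L_x c plus \<open>d d\<close> of the contraction of \<open>c\<close>. The
  first two terms cancel by \<open>lie_act_differential\<close>; the third vanishes by
  induction.\<close>

theorem differential_differential:
  "cochain k c \<Longrightarrow> vs \<in> vec_lists L (Suc (Suc k)) \<Longrightarrow> differential (Suc k) (differential k c) vs = 0"
proof (induction k arbitrary: c vs)
  case 0
  then obtain x ws where vs: "vs = x # ws" "x \<in> L" "ws \<in> vec_lists L (Suc 0)"
    by (auto elim: vec_lists_SucE)
  \<comment> \<open>In degree 0 there is nothing to contract, so Cartan's formula degenerates to
    \<open>d c\<close> on \<open>x\<close> being L_x c.\<close>
  have "differential 0 (contract x (differential 0 c)) ws = differential 0 (lie_act x c) ws"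
    using vs by (intro differential_cong) (auto simp: vec_lists_0 differential_0)
  then show ?case
    using vs 0 by (simp add: cartan_formula cochain_differential lie_act_differential del: cochain.simps)
next
  case (Suc k)
  note [simp del] = cochain.simps
  note c = Suc.prems(1)
  from Suc.prems(2) obtain x ws where vs: "vs = x # ws" "x \<in> L" "ws \<in> vec_lists L (Suc (Suc k))"
    by (rule vec_lists_SucE)
  note cx = cochain_contract[OF c vs(2)]
  have "differential (Suc k) (contract x (differential (Suc k) c)) ws =
      differential (Suc k) (\<lambda>us. lie_act x c us - differential k (contract x c) us) ws"
    using c vs by (intro differential_cong cartan_formula)
  also have "\<dots> = differential (Suc k) (lie_act x c) ws - differential (Suc k) (differential k (contract x c)) ws"
    using c cx vs by (intro differential_diff cochain_lie_act cochain_differential)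
  also have "\<dots> = differential (Suc k) (lie_act x c) ws"
    using Suc.IH[OF cx vs(3)] by simp
  finally show ?case
    using vs c by (simp add: cartan_formula cochain_differential lie_act_differential)
qed

end


section \<open>Smooth functions and vector fields\<close>

lemma Ck_on_cong:
  "open S \<Longrightarrow> Ck_on n S f \<Longrightarrow> (\<And>x. x \<in> S \<Longrightarrow> f x = g x) \<Longrightarrow> Ck_on n S g"
proof (induction n arbitrary: f g)
  case 0
  then show ?case by (simp cong: continuous_on_cong)
next
  case (Suc n)
  \<comment> \<open>Derivatives are taken in the full space; as \<open>S\<close> is open, agreement
    on \<open>S\<close> determines them at its points.\<close>
  have g: "(g has_derivative frechet_derivative f (at x)) (at x)" if x: "x \<in> S" for x
  proof (rule has_derivative_transform_within_open[OF _ Suc.prems(1) x Suc.prems(3)])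
    show "(f has_derivative frechet_derivative f (at x)) (at x)"
      using Suc.prems(2) x by (simp flip: frechet_derivative_works)
  qed
  have eq: "frechet_derivative g (at x) = frechet_derivative f (at x)" if "x \<in> S" for x
    using frechet_derivative_at[OF g[OF that]] by simp
  have "Ck_on n S (\<lambda>x. frechet_derivative g (at x) v)" for v
    by (rule Suc.IH[of "\<lambda>x. frechet_derivative f (at x) v"]) (use Suc.prems(1,2) eq in simp_all)
  then show ?case using g by (auto simp: differentiable_def)
qed

lemma Ck_on_SucD: "Ck_on (Suc n) S f \<Longrightarrow> Ck_on n S f"
proof (induction n arbitrary: f)
  case 0
  then show ?case
    by (auto intro: continuous_at_imp_continuous_on differentiable_imp_continuous_within)
next
  case (Suc n)
  then show ?case by auto
qed

text \<open>By uniqueness of derivatives any explicit \<open>D\<close> may stand in for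
  \<open>frechet_derivative\<close>; the closure properties below are inductions through this
  rule.\<close>

lemma Ck_on_SucI:
  assumes "open S" "\<And>x. x \<in> S \<Longrightarrow> (f has_derivative D x) (at x)" "\<And>v. Ck_on n S (\<lambda>x. D x v)"
  shows "Ck_on (Suc n) S f"
proof -
  have "D x = frechet_derivative f (at x)" if "x \<in> S" for x
    using assms(2)[OF that] by (rule frechet_derivative_at)
  then have "Ck_on n S (\<lambda>x. frechet_derivative f (at x) v)" for v
    by (intro Ck_on_cong[OF assms(1) assms(3)[of v]]) simp
  then show ?thesis using assms(2) by (auto simp: differentiable_def)
qed

lemma Ck_on_const: "open S \<Longrightarrow> Ck_on n S (\<lambda>_. c)"
proof (induction n arbitrary: c)
  case (Suc n)
  then show ?case by (intro Ck_on_SucI[where D = "\<lambda>_ _. 0"]) simp_all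
qed simp

lemma Ck_on_comb:
  fixes f g :: "'a::real_normed_vector \<Rightarrow> 'b::real_normed_vector"
  shows "open S \<Longrightarrow> Ck_on n S f \<Longrightarrow> Ck_on n S g \<Longrightarrow> Ck_on n S (\<lambda>x. a *\<^sub>R f x + b *\<^sub>R g x)"
proof (induction n arbitrary: f g)
  case 0
  then show ?case by (auto intro!: continuous_intros)
next
  case (Suc n)
  show ?case
  proof (rule Ck_on_SucI[OF Suc.prems(1)])
    fix x assume "x \<in> S"
    with Suc.prems have "(f has_derivative frechet_derivative f (at x)) (at x)"
      "(g has_derivative frechet_derivative g (at x)) (at x)"
      by (simp_all flip: frechet_derivative_works)
    then show "((\<lambda>x. a *\<^sub>R f x + b *\<^sub>R g x) has_derivative
        (\<lambda>v. a *\<^sub>R frechet_derivative f (at x) v + b *\<^sub>R frechet_derivative g (at x) v)) (at x)"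
      by (intro derivative_intros)
  next
    show "Ck_on n S (\<lambda>x. a *\<^sub>R frechet_derivative f (at x) v + b *\<^sub>R frechet_derivative g (at x) v)" for v
      using Suc.prems by (intro Suc.IH) simp_all
  qed
qed

lemma Ck_on_mult:
  fixes f g :: "'a::real_normed_vector \<Rightarrow> 'b::real_normed_algebra"
  shows "open S \<Longrightarrow> Ck_on n S f \<Longrightarrow> Ck_on n S g \<Longrightarrow> Ck_on n S (\<lambda>x. f x * g x)"
proof (induction n arbitrary: f g)
  case 0
  then show ?case by (auto intro!: continuous_intros)
next
  case (Suc n)
  show ?case
  proof (rule Ck_on_SucI[OF Suc.prems(1)])
    fix x assume "x \<in> S"
    with Suc.prems have "(f has_derivative frechet_derivative f (at x)) (at x)"
      "(g has_derivative frechet_derivative g (at x)) (at x)"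
      by (simp_all flip: frechet_derivative_works)
    then show "((\<lambda>x. f x * g x) has_derivative
        (\<lambda>v. f x * frechet_derivative g (at x) v + frechet_derivative f (at x) v * g x)) (at x)"
      by (rule has_derivative_mult)
  next
    fix v
    \<comment> \<open>Each product pairs a derivative with an undifferentiated factor, whose order
      is lowered by \<open>Ck_on_SucD\<close>. The coefficients \<open>1\<close> fit
      \<open>Ck_on_comb\<close>.\<close>
    have "Ck_on n S (\<lambda>x. 1 *\<^sub>R (f x * frechet_derivative g (at x) v)
        + 1 *\<^sub>R (frechet_derivative f (at x) v * g x))"
      using Suc.prems Ck_on_SucD[OF Suc.prems(2)] Ck_on_SucD[OF Suc.prems(3)]
      by (intro Ck_on_comb Suc.IH) simp_all
    then show "Ck_on n S (\<lambda>x. f x * frechet_derivative g (at x) v + frechet_derivative f (at x) v * g x)"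
      by simp
  qed
qed

section \<open>Hamiltonian and symmetry fields of a form\<close>

text \<open>Hamiltonian fields in the sense of multisymplectic geometry. Here \<open>k\<close> is
  the degree of the potential \<open>\<sigma>\<close>, two less than that of
  \<open>\<psi>\<close>.\<close>

definition hamiltonian_fields :: "('a, 'n::finite) atlas \<Rightarrow> nat \<Rightarrow> 'a dform \<Rightarrow> 'a vfield set" where
  "hamiltonian_fields A k \<psi> =
     {X \<in> vector_fields A. \<exists>\<sigma>. has_ext_deriv A k \<sigma> (interior_field X \<psi>)}"

text \<open>Here \<open>k\<close> is the degree of \<open>\<psi>\<close> itself.\<close>

definition symmetry_fields :: "('a, 'n::finite) atlas \<Rightarrow> nat \<Rightarrow> 'a dform \<Rightarrow> 'a vfield set" where
  "symmetry_fields A k \<psi> = {X \<in> vector_fields A. has_lie_deriv A X k \<psi> (\<lambda>p vs. 0)}"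

lemma subspace_combI:
  assumes "0 \<in> S" "\<And>x y a b. x \<in> S \<Longrightarrow> y \<in> S \<Longrightarrow> a *\<^sub>R x + b *\<^sub>R y \<in> S"
  shows "subspace S"
  using assms(1) assms(2)[of _ _ 1 1] assms(2)[of _ 0 _ 0] by (auto simp: subspace_def)

lemma sum_fun_apply: "(\<Sum>i\<in>I. f i) p = (\<Sum>i\<in>I. f i p)"
  by (induction I rule: infinite_finite_induct) auto

lemma eval_form_Cons: "eval_form \<omega> (X # Ys) = eval_form (interior_field X \<omega>) Ys"
  by (simp add: eval_form_def interior_field_def interior_def)

lemma eval_form_comb:
  "eval_form (a *\<^sub>R \<omega> + b *\<^sub>R \<omega>') = (\<lambda>Ys. a *\<^sub>R eval_form \<omega> Ys + b *\<^sub>R eval_form \<omega>' Ys)"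
  by (simp add: eval_form_def scaleR_fun_def fun_eq_iff)

lemma eval_form_zero: "eval_form (\<lambda>p vs. 0) = (\<lambda>Ys. 0)"
  by (simp add: eval_form_def fun_eq_iff)

section \<open>Smooth functions, tangent vectors and the Lie algebra of vector fields\<close>

context
  fixes A :: "('a::{t2_space, second_countable_topology}, 'n::finite) atlas"
  assumes A: "smooth_manifold A"
begin

lemma open_chart_image: "(U, h) \<in> A \<Longrightarrow> open (h ` U)"
  using A by (auto simp: smooth_manifold_def)

lemma smooth_functions_iff:
  "f \<in> smooth_functions A \<longleftrightarrow> (\<forall>U h n. (U, h) \<in> A \<longrightarrow> Ck_on n (h ` U) (\<lambda>x. f (inv_into U h x)))"
  by (auto simp: smooth_functions_def smooth_on_def comp_def)

lemma smooth_functions_const: "(\<lambda>_. c) \<in> smooth_functions A"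
  by (simp add: smooth_functions_iff Ck_on_const open_chart_image)

lemma smooth_functions_comb:
  assumes "f \<in> smooth_functions A" "g \<in> smooth_functions A"
  shows "(\<lambda>x. a * f x + b * g x) \<in> smooth_functions A"
  unfolding smooth_functions_iff
proof (intro allI impI)
  fix U h n assume "(U, h) \<in> A"
  with assms show "Ck_on n (h ` U) (\<lambda>x. a * f (inv_into U h x) + b * g (inv_into U h x))"
    unfolding smooth_functions_iff real_scaleR_def[symmetric]
    by (intro Ck_on_comb) (auto intro: open_chart_image)
qed

lemma smooth_functions_mult:
  assumes "f \<in> smooth_functions A" "g \<in> smooth_functions A"
  shows "(\<lambda>x. f x * g x) \<in> smooth_functions A"
  using assms by (simp add: smooth_functions_iff Ck_on_mult open_chart_image)

lemma subspace_smooth_functions: "subspace (smooth_functions A)"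
proof (rule subspaceI)
  show "0 \<in> smooth_functions A"
    using smooth_functions_const[of 0] by (simp add: zero_fun_def)
  show "f + g \<in> smooth_functions A" if "f \<in> smooth_functions A" "g \<in> smooth_functions A" for f g
    using smooth_functions_comb[OF that, of 1 1] by (simp add: plus_fun_def)
  show "c *\<^sub>R f \<in> smooth_functions A" if "f \<in> smooth_functions A" for c f
    using smooth_functions_comb[OF that that, of c 0] by (simp add: scaleR_fun_def)
qed

lemma tangent_comb:
  "v \<in> tangent_space A p \<Longrightarrow> f \<in> smooth_functions A \<Longrightarrow> g \<in> smooth_functions A \<Longrightarrow>
    v (\<lambda>x. a * f x + b * g x) = a * v f + b * v g"
  by (auto simp: tangent_space_def)

lemma tangent_mult:
  "v \<in> tangent_space A p \<Longrightarrow> f \<in> smooth_functions A \<Longrightarrow> g \<in> smooth_functions A \<Longrightarrow>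
    v (\<lambda>x. f x * g x) = f p * v g + g p * v f"
  by (auto simp: tangent_space_def)

lemma tangent_not_smooth: "v \<in> tangent_space A p \<Longrightarrow> f \<notin> smooth_functions A \<Longrightarrow> v f = 0"
  by (auto simp: tangent_space_def)

lemma tangent_zero: "v \<in> tangent_space A p \<Longrightarrow> v (\<lambda>_. 0) = 0"
  using tangent_comb[of v p "\<lambda>_. 0" "\<lambda>_. 0" 0 0] smooth_functions_const by simp

lemma tangent_diff:
  "v \<in> tangent_space A p \<Longrightarrow> f \<in> smooth_functions A \<Longrightarrow> g \<in> smooth_functions A \<Longrightarrow>
    v (\<lambda>x. f x - g x) = v f - v g"
  using tangent_comb[of v p f g 1 "-1"] by simp

lemma subspace_tangent_space: "subspace (tangent_space A p)"
  by (auto simp: subspace_def tangent_space_def zero_fun_def plus_fun_def scaleR_fun_def algebra_simps)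

lemma subspace_vector_fields: "subspace (vector_fields A)"
proof (rule subspaceI)
  show "0 \<in> vector_fields A"
    using smooth_functions_const[of 0] subspace_tangent_space[THEN subspace_0]
    by (simp add: vector_fields_def)
next
  fix X Y assume X: "X \<in> vector_fields A" and Y: "Y \<in> vector_fields A"
  have "(\<lambda>p. X p f + Y p f) \<in> smooth_functions A" if "f \<in> smooth_functions A" for f
    using X Y that smooth_functions_comb[of "\<lambda>p. X p f" "\<lambda>p. Y p f" 1 1]
    by (simp add: vector_fields_def)
  with X Y show "X + Y \<in> vector_fields A"
    by (simp add: vector_fields_def subspace_add[OF subspace_tangent_space])
next
  fix X and c :: real assume X: "X \<in> vector_fields A"
  have "(\<lambda>p. c * X p f) \<in> smooth_functions A" if "f \<in> smooth_functions A" for f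
    using X that smooth_functions_comb[of "\<lambda>p. X p f" "\<lambda>p. X p f" c 0]
    by (simp add: vector_fields_def)
  with X show "c *\<^sub>R X \<in> vector_fields A"
    using subspace_scale[OF subspace_tangent_space]
    by (simp add: vector_fields_def scaleR_fun_def)
qed

lemma vector_fields_tangent: "X \<in> vector_fields A \<Longrightarrow> X p \<in> tangent_space A p"
  by (auto simp: vector_fields_def)

lemma vector_fields_smooth:
  "X \<in> vector_fields A \<Longrightarrow> f \<in> smooth_functions A \<Longrightarrow> (\<lambda>p. X p f) \<in> smooth_functions A"
  by (auto simp: vector_fields_def)

lemma vector_fields_not_smooth: "X \<in> vector_fields A \<Longrightarrow> f \<notin> smooth_functions A \<Longrightarrow> X p f = 0"
  using vector_fields_tangent tangent_not_smooth by blast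

lemma lie_bracket_vector_fields:
  assumes X: "X \<in> vector_fields A" and Y: "Y \<in> vector_fields A"
  shows "lie_bracket X Y \<in> vector_fields A"
proof -
  note t = vector_fields_tangent[OF X] vector_fields_tangent[OF Y]
  note s = vector_fields_smooth[OF X] vector_fields_smooth[OF Y]
  \<comment> \<open>The product rule applied twice. The mixed terms are symmetric in
    \<open>Z\<close> and \<open>W\<close>, so they cancel in the bracket, which is therefore a
    derivation again.\<close>
  have prod: "Z p (\<lambda>q. f q * W q g + g q * W q f) =
      f p * Z p (\<lambda>q. W q g) + W p g * Z p f + (g p * Z p (\<lambda>q. W q f) + W p f * Z p g)"
    if Z: "Z \<in> vector_fields A" and W: "W \<in> vector_fields A"
      and fg: "f \<in> smooth_functions A" "g \<in> smooth_functions A"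
    for Z W f g p
    using W fg
      tangent_comb[OF vector_fields_tangent[OF Z], of "\<lambda>q. f q * W q g" "\<lambda>q. g q * W q f" p 1 1]
    by (simp add: smooth_functions_mult vector_fields_smooth tangent_mult[OF vector_fields_tangent[OF Z]])
  \<comment> \<open>The default value 0 is inherited: off the smooth functions each inner function
    is zero, and tangent vectors kill the zero function.\<close>
  have "lie_bracket X Y p \<in> tangent_space A p" for p
    unfolding tangent_space_def
    using X Y s
    by (auto simp: lie_bracket_def tangent_comb[OF t(1)] tangent_comb[OF t(2)] tangent_mult[OF t(1)]
        tangent_mult[OF t(2)] prod vector_fields_not_smooth tangent_zero[OF t(1)] tangent_zero[OF t(2)]
        algebra_simps)
  moreover have "(\<lambda>p. lie_bracket X Y p f) \<in> smooth_functions A" if "f \<in> smooth_functions A" for f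
    unfolding lie_bracket_def using that s smooth_functions_comb[where a = 1 and b = "-1"] by fastforce
  ultimately show ?thesis by (simp add: vector_fields_def)
qed

lemma lie_algebra_vector_fields: "lie_algebra (vector_fields A) lie_bracket"
proof -
  have "lie_bracket (a *\<^sub>R X + b *\<^sub>R Y) Z = a *\<^sub>R lie_bracket X Z + b *\<^sub>R lie_bracket Y Z"
    "lie_bracket Z (a *\<^sub>R X + b *\<^sub>R Y) = a *\<^sub>R lie_bracket Z X + b *\<^sub>R lie_bracket Z Y"
    if X: "X \<in> vector_fields A" and Y: "Y \<in> vector_fields A" and Z: "Z \<in> vector_fields A" for X Y Z a b
  proof -
    have "Z p (\<lambda>q. a * X q f + b * Y q f) = a * Z p (\<lambda>q. X q f) + b * Z p (\<lambda>q. Y q f)" for p f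
    proof (cases "f \<in> smooth_functions A")
      case True
      then show ?thesis
        using X Y by (simp add: tangent_comb[OF vector_fields_tangent[OF Z]] vector_fields_smooth)
    next
      \<comment> \<open>By the default value of tangent vectors both inner functions are
        zero.\<close>
      case False
      then show ?thesis
        using X Y by (simp add: vector_fields_not_smooth tangent_zero[OF vector_fields_tangent[OF Z]])
    qed
    then show "lie_bracket (a *\<^sub>R X + b *\<^sub>R Y) Z = a *\<^sub>R lie_bracket X Z + b *\<^sub>R lie_bracket Y Z"
      "lie_bracket Z (a *\<^sub>R X + b *\<^sub>R Y) = a *\<^sub>R lie_bracket Z X + b *\<^sub>R lie_bracket Z Y"
      by (auto simp: lie_bracket_def fun_eq_iff scaleR_fun_def algebra_simps)
  qed
  moreover have "lie_bracket X X = 0" for X :: "'a vfield"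
    by (simp add: lie_bracket_def zero_fun_def)
  moreover have "lie_bracket X (lie_bracket Y Z) + lie_bracket Y (lie_bracket Z X)
      + lie_bracket Z (lie_bracket X Y) = 0"
    if "X \<in> vector_fields A" "Y \<in> vector_fields A" "Z \<in> vector_fields A" for X Y Z
  proof -
    \<comment> \<open>With the outer field distributed over the inner bracket, the twelve triple
      compositions of the Jacobi sum cancel in pairs.\<close>
    have *: "W p (\<lambda>q. U q (\<lambda>r. V r f) - V q (\<lambda>r. U r f)) =
        W p (\<lambda>q. U q (\<lambda>r. V r f)) - W p (\<lambda>q. V q (\<lambda>r. U r f))"
      if W: "W \<in> vector_fields A" and U: "U \<in> vector_fields A" and V: "V \<in> vector_fields A"
      for W U V p f
    proof (cases "f \<in> smooth_functions A")
      case True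
      then show ?thesis
        using U V by (simp add: tangent_diff[OF vector_fields_tangent[OF W]] vector_fields_smooth)
    next
      case False
      then show ?thesis
        using U V by (simp add: vector_fields_not_smooth tangent_zero[OF vector_fields_tangent[OF W]]
            tangent_zero[OF vector_fields_tangent[OF U]] tangent_zero[OF vector_fields_tangent[OF V]])
    qed
    show ?thesis
      using that by (simp add: lie_bracket_def fun_eq_iff *)
  qed
  ultimately show ?thesis
    unfolding lie_algebra_def
    using subspace_vector_fields lie_bracket_vector_fields by blast
qed

text \<open>The law \<open>act_br\<close> is the definition of \<open>lie_bracket\<close>. After the
  interpretation below, \<open>cochain\<close>, \<open>differential\<close> and
  \<open>lie_act\<close> refer to this module.\<close>

lemma lie_module_vector_fields:
  "lie_module (vector_fields A) lie_bracket (smooth_functions A) (\<lambda>X f p. X p f)"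
proof unfold_locales
  show "lie_algebra (vector_fields A) lie_bracket" by (rule lie_algebra_vector_fields)
  show "subspace (smooth_functions A)" by (rule subspace_smooth_functions)
  show "(\<lambda>p. X p (a *\<^sub>R f + b *\<^sub>R g)) = a *\<^sub>R (\<lambda>p. X p f) + b *\<^sub>R (\<lambda>p. X p g)"
    if "X \<in> vector_fields A" "f \<in> smooth_functions A" "g \<in> smooth_functions A" for X f g a b
    using tangent_comb[OF vector_fields_tangent[OF that(1)] that(2,3)]
    by (simp add: scaleR_fun_def plus_fun_def)
qed (simp_all add: lie_bracket_def fun_eq_iff scaleR_fun_def vector_fields_smooth)

interpretation lie_module "vector_fields A" lie_bracket "smooth_functions A" "\<lambda>X f p. X p f"
  by (rule lie_module_vector_fields)

section \<open>Differential forms as cochains on vector fields\<close>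

lemma diff_form_interior_field:
  assumes "diff_form A (Suc k) \<omega>" "X \<in> vector_fields A"
  shows "diff_form A k (interior_field X \<omega>)"
proof -
  have "alternating_form (tangent_space A p) k (interior (X p) (\<omega> p))" for p
  proof -
    have alt: "alternating_form (tangent_space A p) (Suc k) (\<omega> p)"
      using assms by (simp add: diff_form_def)
    have X: "X p \<in> tangent_space A p" using assms by (simp add: vector_fields_tangent)
    show ?thesis unfolding alternating_form_def interior_def
    proof (intro conjI ballI allI impI)
      fix vs i x y a b
      assume "vs \<in> vec_lists (tangent_space A p) k" "i < k"
        "x \<in> tangent_space A p" "y \<in> tangent_space A p"
      \<comment> \<open>Slot \<open>i\<close> of the contracted form is slot \<open>Suc i\<close> of
        \<open>\<omega>\<close>.\<close>
      then show "\<omega> p (X p # vs[i := a *\<^sub>R x + b *\<^sub>R y]) =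
          a * \<omega> p (X p # vs[i := x]) + b * \<omega> p (X p # vs[i := y])"
        using alt[unfolded alternating_form_def, THEN conjunct1, rule_format, of "X p # vs" "Suc i" x y a b] X
        by (simp add: Cons_in_vec_lists)
    next
      fix vs i j
      assume "vs \<in> vec_lists (tangent_space A p) k" "i < k" "j < k" "i \<noteq> j \<and> vs ! i = vs ! j"
      then show "\<omega> p (X p # vs) = 0"
        using alt[unfolded alternating_form_def, THEN conjunct2, rule_format, of "X p # vs" "Suc i" "Suc j"] X
        by (simp add: Cons_in_vec_lists)
    qed
  qed
  then show ?thesis
    using assms unfolding diff_form_def eval_form_Cons[symmetric]
    by (simp add: interior_field_def Cons_in_vec_lists)
qed

lemma eval_vec_lists:
  "Ys \<in> vec_lists (vector_fields A) k \<Longrightarrow> map (\<lambda>Y. Y p) Ys \<in> vec_lists (tangent_space A p) k"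
  by (auto simp: vec_lists_def vector_fields_tangent)

text \<open>The passage from pointwise forms to the algebra above. Linearity is read off in slot 0
  and alternation in slots 0 and 1; later slots are reached through contraction.\<close>

lemma cochain_eval_form: "diff_form A k \<omega> \<Longrightarrow> cochain k (eval_form \<omega>)"
proof (induction k arbitrary: \<omega>)
  case 0
  then show ?case by (simp add: diff_form_def vec_lists_0)
next
  case (Suc k)
  have alt: "alternating_form (tangent_space A p) (Suc k) (\<omega> p)" for p
    using Suc.prems by (simp add: diff_form_def)
  have "cochain k (contract X (eval_form \<omega>))" if "X \<in> vector_fields A" for X
    unfolding eval_form_Cons using Suc that by (intro Suc.IH diff_form_interior_field)
  moreover have "eval_form \<omega> ((a *\<^sub>R X + b *\<^sub>R Y) # Ys) p =
      (a *\<^sub>R eval_form \<omega> (X # Ys) + b *\<^sub>R eval_form \<omega> (Y # Ys)) p"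
    if "X \<in> vector_fields A" "Y \<in> vector_fields A" "Ys \<in> vec_lists (vector_fields A) k" for X Y a b Ys p
    using alt[unfolded alternating_form_def, THEN conjunct1, rule_format,
        of "map (\<lambda>Y. Y p) (X # Ys)" p 0 "X p" "Y p" a b]
      eval_vec_lists[of "X # Ys" "Suc k" p] that
    by (simp add: eval_form_def scaleR_fun_def Cons_in_vec_lists vector_fields_tangent)
  moreover have "eval_form \<omega> (X # X # Ys) p = 0"
    if "X # Ys \<in> vec_lists (vector_fields A) k" for X Ys p
  proof -
    have "X \<in> vector_fields A" "0 < k" using that by (auto simp: vec_lists_def)
    then show ?thesis
      using alt[unfolded alternating_form_def, THEN conjunct2, rule_format,
          of "map (\<lambda>Y. Y p) (X # X # Ys)" p 0 1]
        eval_vec_lists[of "X # X # Ys" "Suc k" p] that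
      by (simp add: eval_form_def Cons_in_vec_lists)
  qed
  ultimately show ?case by (auto simp: fun_eq_iff)
qed

text \<open>One formula read in two ways: the sums are taken at a point or in the space of
  functions.\<close>

lemma ext_deriv_eq_differential: "ext_deriv k \<omega> Ys = differential k (eval_form \<omega>) Ys"
  by (simp add: ext_deriv_def differential_def fun_eq_iff sum_fun_apply scaleR_fun_def)

lemma lie_deriv_eq_lie_act: "lie_deriv X \<omega> Ys = lie_act X (eval_form \<omega>) Ys"
  by (simp add: lie_deriv_def lie_act_def fun_eq_iff sum_fun_apply)

lemma diff_form_comb:
  assumes "diff_form A k \<omega>" "diff_form A k \<omega>'"
  shows "diff_form A k (a *\<^sub>R \<omega> + b *\<^sub>R \<omega>')"
proof -
  have "alternating_form (tangent_space A p) k ((a *\<^sub>R \<omega> + b *\<^sub>R \<omega>') p)" for p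
    using assms unfolding diff_form_def alternating_form_def scaleR_fun_def plus_fun_apply
    by (simp add: algebra_simps)
  moreover have "eval_form (a *\<^sub>R \<omega> + b *\<^sub>R \<omega>') Ys = (\<lambda>p. a * eval_form \<omega> Ys p + b * eval_form \<omega>' Ys p)" for Ys
    by (simp add: eval_form_def scaleR_fun_def)
  ultimately show ?thesis
    using assms by (auto simp: diff_form_def intro: smooth_functions_comb)
qed

lemma diff_form_zero: "diff_form A k (\<lambda>p vs. 0)"
  by (simp add: diff_form_def alternating_form_def eval_form_def smooth_functions_const)

section \<open>Symmetry and Hamiltonian fields as Lie subalgebras\<close>

lemma symmetry_fields_iff:
  assumes "diff_form A k \<psi>"
  shows "X \<in> symmetry_fields A k \<psi> \<longleftrightarrow> X \<in> vector_fields A \<and>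
    (\<forall>Ys\<in>vec_lists (vector_fields A) k. lie_act X (eval_form \<psi>) Ys = 0)"
  using assms
  by (auto simp: symmetry_fields_def has_lie_deriv_def lie_deriv_eq_lie_act
      diff_form_zero eval_form_zero)

lemma hamiltonian_fields_iff:
  assumes "diff_form A (Suc (Suc k)) \<psi>"
  shows "X \<in> hamiltonian_fields A k \<psi> \<longleftrightarrow> X \<in> vector_fields A \<and>
    (\<exists>\<sigma>. diff_form A k \<sigma> \<and> (\<forall>Ys\<in>vec_lists (vector_fields A) (Suc k).
      differential k (eval_form \<sigma>) Ys = eval_form \<psi> (X # Ys)))"
  using assms
  by (auto simp: hamiltonian_fields_def has_ext_deriv_def ext_deriv_eq_differential
      eval_form_Cons diff_form_interior_field)

lemma lie_subalgebra_symmetry_fields: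
  assumes \<psi>: "diff_form A k \<psi>"
  shows "lie_subalgebra (symmetry_fields A k \<psi>) (vector_fields A) lie_bracket"
proof -
  note c = cochain_eval_form[OF \<psi>]
  note iff = symmetry_fields_iff[OF \<psi>]
  have zero: "0 \<in> vector_fields A" by (rule subspace_0[OF subspace_L])
  have "subspace (symmetry_fields A k \<psi>)"
  proof (rule subspace_combI)
    show "0 \<in> symmetry_fields A k \<psi>"
      using lie_act_linear_left[OF c zero zero, of _ 0 0] zero by (simp add: iff)
    fix X Y :: "'a vfield" and a b :: real
    assume "X \<in> symmetry_fields A k \<psi>" "Y \<in> symmetry_fields A k \<psi>"
    then show "a *\<^sub>R X + b *\<^sub>R Y \<in> symmetry_fields A k \<psi>"
      using subspace_L by (simp add: iff lie_act_linear_left[OF c] subspace_add subspace_scale)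
  qed
  moreover have "lie_bracket X Y \<in> symmetry_fields A k \<psi>"
    if X: "X \<in> symmetry_fields A k \<psi>" and Y: "Y \<in> symmetry_fields A k \<psi>" for X Y
  proof -
    \<comment> \<open>The inner Lie derivative vanishes only on lists of vector fields, hence the
      comparison with the zero cochain by \<open>lie_act_cong\<close>. With
      \<open>lie_act_br\<close> this handles both compositions in the commutator.\<close>
    have "lie_act U (lie_act V (eval_form \<psi>)) Ys = 0"
      if "U \<in> symmetry_fields A k \<psi>" "V \<in> symmetry_fields A k \<psi>" "Ys \<in> vec_lists (vector_fields A) k"
      for U V Ys
      using that lie_act_cong[of k "lie_act V (eval_form \<psi>)" "\<lambda>_. 0" U Ys]
      by (simp add: iff lie_act_zero)
    with X Y show ?thesis by (simp add: iff br_closed lie_act_br[OF c])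
  qed
  ultimately show ?thesis
    using lie_algebra by (auto simp: lie_subalgebra_def iff)
qed

text \<open>On lists of vector fields the contraction is \<open>d \<sigma>\<close> for a potential
  \<open>\<sigma>\<close>, so this is \<open>d d = 0\<close>.\<close>

lemma differential_contract_hamiltonian:
  assumes \<psi>: "diff_form A (Suc (Suc k)) \<psi>" and X: "X \<in> hamiltonian_fields A k \<psi>"
    and Ys: "Ys \<in> vec_lists (vector_fields A) (Suc (Suc k))"
  shows "differential (Suc k) (contract X (eval_form \<psi>)) Ys = 0"
proof -
  obtain \<sigma> where \<sigma>: "diff_form A k \<sigma>"
    "\<And>Zs. Zs \<in> vec_lists (vector_fields A) (Suc k) \<Longrightarrow>
      differential k (eval_form \<sigma>) Zs = eval_form \<psi> (X # Zs)"
    using X by (auto simp: hamiltonian_fields_iff[OF \<psi>])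
  have "differential (Suc k) (contract X (eval_form \<psi>)) Ys =
      differential (Suc k) (differential k (eval_form \<sigma>)) Ys"
    using Ys by (intro differential_cong) (auto simp: \<sigma>(2))
  then show ?thesis
    using differential_differential[OF cochain_eval_form[OF \<sigma>(1)] Ys] by simp
qed

text \<open>In Cartan's formula for the Lie derivative of \<open>\<psi>\<close> along
  \<open>X\<close>, one term vanishes because \<open>\<psi>\<close> is closed, the other because its
  contraction with \<open>X\<close> is exact.\<close>

lemma hamiltonian_fields_subset_symmetry_fields:
  assumes closed: "has_ext_deriv A (Suc (Suc k)) \<psi> (\<lambda>p vs. 0)"
  shows "hamiltonian_fields A k \<psi> \<subseteq> symmetry_fields A (Suc (Suc k)) \<psi>"
proof
  fix X assume X: "X \<in> hamiltonian_fields A k \<psi>"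
  have \<psi>: "diff_form A (Suc (Suc k)) \<psi>" using closed by (simp add: has_ext_deriv_def)
  have Xv: "X \<in> vector_fields A" using X by (simp add: hamiltonian_fields_def)
  have "lie_act X (eval_form \<psi>) Ys = 0" if Ys: "Ys \<in> vec_lists (vector_fields A) (Suc (Suc k))" for Ys
  proof -
    have "differential (Suc (Suc k)) (eval_form \<psi>) (X # Ys) = 0"
      using closed Xv Ys
      by (simp add: has_ext_deriv_def ext_deriv_eq_differential eval_form_zero
          Cons_in_vec_lists)
    then show ?thesis
      using cartan_formula[OF cochain_eval_form[OF \<psi>] Xv Ys] differential_contract_hamiltonian[OF \<psi> X Ys]
      by simp
  qed
  with Xv show "X \<in> symmetry_fields A (Suc (Suc k)) \<psi>" by (simp add: symmetry_fields_iff[OF \<psi>])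
qed

text \<open>Potentials combine with the same coefficients as the fields; the zero field has the zero
  form as potential.\<close>

lemma subspace_hamiltonian_fields:
  assumes \<psi>: "diff_form A (Suc (Suc k)) \<psi>"
  shows "subspace (hamiltonian_fields A k \<psi>)"
proof (rule subspace_combI)
  note c = cochain_eval_form[OF \<psi>]
  note iff = hamiltonian_fields_iff[OF \<psi>]
  have zero: "0 \<in> vector_fields A" by (rule subspace_0[OF subspace_L])
  have "differential k (eval_form (\<lambda>p vs. 0)) Ys = eval_form \<psi> (0 # Ys)"
    if "Ys \<in> vec_lists (vector_fields A) (Suc k)" for Ys
    using that cochain_linear[OF c zero zero that, of 0 0]
    by (simp add: eval_form_zero differential_zero)
  then show "0 \<in> hamiltonian_fields A k \<psi>"
    using diff_form_zero[of k] zero by (auto simp: iff)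
  fix X Y :: "'a vfield" and a b :: real
  assume X: "X \<in> hamiltonian_fields A k \<psi>" and Y: "Y \<in> hamiltonian_fields A k \<psi>"
  obtain \<sigma> where \<sigma>: "diff_form A k \<sigma>"
    "\<And>Zs. Zs \<in> vec_lists (vector_fields A) (Suc k) \<Longrightarrow>
      differential k (eval_form \<sigma>) Zs = eval_form \<psi> (X # Zs)"
    using X by (auto simp: iff)
  obtain \<tau> where \<tau>: "diff_form A k \<tau>"
    "\<And>Zs. Zs \<in> vec_lists (vector_fields A) (Suc k) \<Longrightarrow>
      differential k (eval_form \<tau>) Zs = eval_form \<psi> (Y # Zs)"
    using Y by (auto simp: iff)
  have v: "X \<in> vector_fields A" "Y \<in> vector_fields A" using X Y by (auto simp: iff)
  have "differential k (eval_form (a *\<^sub>R \<sigma> + b *\<^sub>R \<tau>)) Ys = eval_form \<psi> ((a *\<^sub>R X + b *\<^sub>R Y) # Ys)"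
    if "Ys \<in> vec_lists (vector_fields A) (Suc k)" for Ys
    using that differential_comb[OF cochain_eval_form[OF \<sigma>(1)] cochain_eval_form[OF \<tau>(1)] that]
      cochain_linear[OF c v that]
    by (simp add: eval_form_comb \<sigma>(2) \<tau>(2))
  then show "a *\<^sub>R X + b *\<^sub>R Y \<in> hamiltonian_fields A k \<psi>"
    using v diff_form_comb[OF \<sigma>(1) \<tau>(1)] subspace_L
    by (auto simp: iff subspace_add subspace_scale)
qed

text \<open>The bracket of \<open>X\<close> and \<open>Y\<close> has the potential \<open>\<psi>(Y, X, \<dots>)\<close>.\<close>

lemma lie_bracket_hamiltonian_fields:
  assumes closed: "has_ext_deriv A (Suc (Suc k)) \<psi> (\<lambda>p vs. 0)"
    and X: "X \<in> hamiltonian_fields A k \<psi>" and Y: "Y \<in> hamiltonian_fields A k \<psi>"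
  shows "lie_bracket X Y \<in> hamiltonian_fields A k \<psi>"
proof -
  have \<psi>: "diff_form A (Suc (Suc k)) \<psi>" using closed by (simp add: has_ext_deriv_def)
  have v: "X \<in> vector_fields A" "Y \<in> vector_fields A"
    using X Y by (auto simp: hamiltonian_fields_def)
  have "differential k (contract X (contract Y (eval_form \<psi>))) Ys = eval_form \<psi> (lie_bracket X Y # Ys)"
    if Ys: "Ys \<in> vec_lists (vector_fields A) (Suc k)" for Ys
  proof -
    have "X \<in> symmetry_fields A (Suc (Suc k)) \<psi>"
      using X hamiltonian_fields_subset_symmetry_fields[OF closed] by blast
    then have "lie_act X (eval_form \<psi>) (Y # Ys) = 0"
      using v Ys by (simp add: symmetry_fields_iff[OF \<psi>] Cons_in_vec_lists)
    moreover have "differential (Suc k) (contract Y (eval_form \<psi>)) (X # Ys) = 0"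
      using v Ys by (intro differential_contract_hamiltonian[OF \<psi> Y]) (simp add: Cons_in_vec_lists)
    \<comment> \<open>Cartan's formula for the contraction of \<open>\<psi>\<close> with
      \<open>Y\<close>, along \<open>X\<close>: its left side vanishes by the second fact, and
      \<open>lie_act_Cons\<close> with the first turns the Lie derivative into the contraction of
      \<open>\<psi>\<close> with the bracket.\<close>
    ultimately show ?thesis
      using cartan_formula[OF cochain_contract[OF cochain_eval_form[OF \<psi>] v(2)] v(1) Ys]
      by (simp add: lie_act_Cons)
  qed
  moreover have "diff_form A k (interior_field X (interior_field Y \<psi>))"
    using \<psi> v by (intro diff_form_interior_field)
  ultimately show ?thesis
    using v by (auto simp: hamiltonian_fields_iff[OF \<psi>] br_closed eval_form_Cons)
qed

end

section \<open>Coclosed G2-structures: the case of the 4-form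
  \<open>g2_star A \<phi>\<close>\<close>

theorem mainTheorem4:
  fixes A :: "('a::{t2_space, second_countable_topology}, 7) atlas"
    and \<phi> :: "'a dform"
  assumes "smooth_manifold A"
    and "g2_structure A \<phi>"
    and "coclosed A \<phi>"
  shows "lie_subalgebra (coRochesterian_fields A \<phi>) (vector_fields A) lie_bracket
    \<and> lie_subalgebra (coG2_fields A \<phi>) (vector_fields A) lie_bracket
    \<and> lie_subalgebra (coRochesterian_fields A \<phi>) (coG2_fields A \<phi>) lie_bracket"
proof -
  let ?\<psi> = "g2_star A \<phi>"
  \<comment> \<open>The degree 4 is written as \<open>Suc (Suc 2)\<close> to fit the general lemmas,
    with potentials of degree 2.\<close>
  have closed: "has_ext_deriv A (Suc (Suc 2)) ?\<psi> (\<lambda>p vs. 0)"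
    using assms(3) by (simp add: coclosed_def)
  then have form: "diff_form A (Suc (Suc 2)) ?\<psi>" by (simp add: has_ext_deriv_def)
  \<comment> \<open>The membership of \<open>d \<sigma>\<close> in \<open>Omega37 A \<phi>\<close>
    is witnessed by the field \<open>X\<close> itself.\<close>
  have roc: "coRochesterian_fields A \<phi> = hamiltonian_fields A 2 ?\<psi>"
    unfolding coRochesterian_fields_def hamiltonian_fields_def coRochesterian_form_def
      Omega37_def has_ext_deriv_def by blast
  have g2: "coG2_fields A \<phi> = symmetry_fields A (Suc (Suc 2)) ?\<psi>"
    by (simp add: coG2_fields_def symmetry_fields_def)
  have sub: "lie_subalgebra (coG2_fields A \<phi>) (vector_fields A) lie_bracket"
    unfolding g2 by (rule lie_subalgebra_symmetry_fields[OF assms(1) form])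
  have incl: "coRochesterian_fields A \<phi> \<subseteq> coG2_fields A \<phi>"
    unfolding g2 roc by (rule hamiltonian_fields_subset_symmetry_fields[OF assms(1) closed])
  have roc_sub: "subspace (coRochesterian_fields A \<phi>)"
    unfolding roc by (rule subspace_hamiltonian_fields[OF assms(1) form])
  have roc_br: "\<forall>X\<in>coRochesterian_fields A \<phi>. \<forall>Y\<in>coRochesterian_fields A \<phi>.
      lie_bracket X Y \<in> coRochesterian_fields A \<phi>"
    unfolding roc using lie_bracket_hamiltonian_fields[OF assms(1) closed] by blast
  \<comment> \<open>The third claim has the coG2 fields as ambient algebra, so the laws are
    restricted to them from all vector fields.\<close>
  have "lie_algebra (coG2_fields A \<phi>) lie_bracket"
    using sub unfolding lie_subalgebra_def lie_algebra_def by (meson subsetD)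
  with sub incl roc_sub roc_br show ?thesis
    unfolding lie_subalgebra_def by (blast intro: subset_trans)
qed

end
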